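(* Let $R$ be an exchange ring and let $n\geq 3$ be an integer. Then \[\operatorname{E}_n(R,I)=[\operatorname{E}_n(R),\operatorname{E}_n(R,I)]=[\operatorname{E}_n(R),\operatorname{C}_n(R,I)]\] for any ideal $I$ of $R$.
   Context: Rings are associative with $1\neq 0$ (not necessarily commutative); an ideal means a two-sided ideal. A left $R$-module $M$ has the exchange property if for any module $X$ and decompositions $X=M'\oplus Y=\bigoplus_{\lambda\in\Lambda}N_\lambda$ with $M'\cong M$ (arbitrary index set $\Lambda$), there exist submodules $N'_\lambda\subseteq N_\lambda$ for each $\lambda$ such that $X=M'\oplus\bigoplus_{\lambda\in\Lambda}N'_\lambda$. A ring $R$ is an exchange ring if ${}_RR$ has the exchange property; equivalently (Nicholson), for every $x\in R$ there is an idempotent $e\in xR$ such that $1-e\in(1-x)R$. $\operatorname{GL}_n(R)$ is the group of invertible $n\times n$ matrices over $R$. Write $e$ for the identity matrix and $e^{ij}$ for the matrix with $1$ at position $(i,j)$ and zeros elsewhere. For $i\neq j$ in $\{1,\dots,n\}$ and $x\in R$, the elementary transvection is $t_{ij}(x)=e+xe^{ij}$. The elementary subgroup $\operatorname{E}_n(R)$ is the subgroup of $\operatorname{GL}_n(R)$ generated by all elementary transvections. For an ideal $I$ of $R$, $\operatorname{E}_n(I)$ is the subgroup generated by all $t_{ij}(x)$ with $x\in I$, $i\ne j$, and the elementary subgroup $\operatorname{E}_n(R,I)$ of level $I$ is the normal closure of $\operatorname{E}_n(I)$ in $\operatorname{E}_n(R)$. The full congruence subgroup of level $I$ is $\operatorname{C}_n(R,I)=\phi^{-1}(\operatorname{Center}(\operatorname{GL}_n(R/I)))$,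 where $\phi:\operatorname{GL}_n(R)\to\operatorname{GL}_n(R/I)$ is induced by the canonical map $R\to R/I$ (for $I=R$ the target is the trivial group, so $\operatorname{C}_n(R,R)=\operatorname{GL}_n(R)$). For elements $g,h$ of a group, $[g,h]=ghg^{-1}h^{-1}$; for subgroups $H,K$, $[H,K]$ is the subgroup generated by all $[h,k]$ with $h\in H$, $k\in K$. *)

theory Defs
  imports
    "HOL-Analysis.Finite_Cartesian_Product"
    "HOL-Algebra.Algebraic_Closure_Type"
    "HOL-Algebra.Generated_Groups"
    "HOL-Algebra.QuotRing"
    "HOL-Algebra.Module"
begin

section \<open>Left modules and the exchange property\<close>

text \<open>
  The library locale for modules requires a commutative ring of scalars and therefore does not
  apply. Scalars are here the elements of a type of class \<open>ring_1\<close>. Only the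
  additive structure and the scalar multiplication of the module record are used; its
  fields \<open>mult\<close> and \<open>one\<close> are irrelevant.
\<close>

locale left_module = abelian_group M for M :: "('a::ring_1, 'x) module" (structure) +
  assumes smult_closed: "x \<in> carrier M \<Longrightarrow> r \<odot> x \<in> carrier M"
    and smult_l_distr: "x \<in> carrier M \<Longrightarrow> (r + s) \<odot> x = r \<odot> x \<oplus> s \<odot> x"
    and smult_r_distr: "x \<in> carrier M \<Longrightarrow> y \<in> carrier M \<Longrightarrow> r \<odot> (x \<oplus> y) = r \<odot> x \<oplus> r \<odot> y"
    and smult_assoc: "x \<in> carrier M \<Longrightarrow> (r * s) \<odot> x = r \<odot> (s \<odot> x)"
    and smult_one: "x \<in> carrier M \<Longrightarrow> 1 \<odot> x = x"

definition left_module_isomorphic ::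
    "('a::ring_1, 'x) module \<Rightarrow> ('a, 'y) module \<Rightarrow> bool" where
  "left_module_isomorphic M N \<longleftrightarrow>
     (\<exists>f. bij_betw f (carrier M) (carrier N) \<and>
        (\<forall>x\<in>carrier M. \<forall>y\<in>carrier M. f (x \<oplus>\<^bsub>M\<^esub> y) = f x \<oplus>\<^bsub>N\<^esub> f y) \<and>
        (\<forall>r. \<forall>x\<in>carrier M. f (r \<odot>\<^bsub>M\<^esub> x) = r \<odot>\<^bsub>N\<^esub> f x))"

text \<open>
  \<open>U\<close> is the internal direct sum of the submodules \<open>N i\<close>, \<open>i \<in> \<Lambda>\<close>: every element is the
  sum of exactly one finitely supported family of elements of the summands.
\<close>

definition is_direct_sum ::
    "('a::ring_1, 'x) module \<Rightarrow> 'i set \<Rightarrow> ('i \<Rightarrow> 'x set) \<Rightarrow> bool" where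
  "is_direct_sum U \<Lambda> N \<longleftrightarrow>
     (\<forall>i\<in>\<Lambda>. submodule (N i) ring_of_type_algebra U) \<and>
     (\<forall>x\<in>carrier U. \<exists>!f. f \<in> (\<Pi>\<^sub>E i\<in>\<Lambda>. N i) \<and> finite {i\<in>\<Lambda>. f i \<noteq> \<zero>\<^bsub>U\<^esub>} \<and>
        x = finsum U f {i\<in>\<Lambda>. f i \<noteq> \<zero>\<^bsub>U\<^esub>})"

text \<open>
  HOL cannot quantify over modules of all types inside a formula, so the type \<open>'x\<close> containing
  the underlying sets of the modules \<open>U\<close> is a parameter. Index sets are subsets of the same
  type, which is no further restriction: the nonzero summands of a direct decomposition of \<open>U\<close>
  are distinguished by the choice of a nonzero element in each, and zero summands play no role.
  The index \<open>None\<close> in the conclusion is that of the summand \<open>M'\<close>.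
\<close>

definition exchange_property :: "'x itself \<Rightarrow> ('a::ring_1, 'm) module \<Rightarrow> bool" where
  "exchange_property _ M \<longleftrightarrow>
     (\<forall>(U :: ('a, 'x) module) M' Y (\<Lambda> :: 'x set) N.
        left_module U \<and>
        left_module_isomorphic (U\<lparr>carrier := M'\<rparr>) M \<and>
        is_direct_sum U (UNIV :: bool set) (\<lambda>b. if b then M' else Y) \<and>
        is_direct_sum U \<Lambda> N
        \<longrightarrow> (\<exists>N'. (\<forall>i\<in>\<Lambda>. submodule (N' i) ring_of_type_algebra U \<and> N' i \<subseteq> N i) \<and>
               is_direct_sum U (insert None (Some ` \<Lambda>)) (case_option M' N')))"

definition regular_left_module :: "('a::ring_1, 'a) module" where
  "regular_left_module =
     \<lparr>carrier = UNIV, monoid.mult = (*), one = 1, zero = 0, add = (+), module.smult = (*)\<rparr>"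

text \<open>
  The type \<open>nat \<Rightarrow> 'a\<close> contains an isomorphic copy of every countably generated left module
  over \<open>'a\<close> (choose representatives in a quotient of the finitely supported sequences).
  For the regular module this yields the unrestricted exchange property: already the instances
  with \<open>U\<close> the free module of rank two, decomposed into its two coordinate summands, imply
  Nicholson's idempotent condition, and that condition implies the exchange property with respect
  to all modules and all index sets. A restricted range of \<open>U\<close> makes the condition formally
  weaker as a hypothesis, never stronger.
\<close>

definition exchange_ring :: "'a::ring_1 itself \<Rightarrow> bool" where
  "exchange_ring _ \<longleftrightarrow>
     exchange_property TYPE(nat \<Rightarrow> 'a) (regular_left_module :: ('a, 'a) module)"

section \<open>Group-theoretic notions\<close>

definition group_center :: "('g, 'b) monoid_scheme \<Rightarrow> 'g set" where
  "group_center G = {z \<in> carrier G. \<forall>g\<in>carrier G. z \<otimes>\<^bsub>G\<^esub> g = g \<otimes>\<^bsub>G\<^esub> z}"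

definition commutator_subgroup :: "('g, 'b) monoid_scheme \<Rightarrow> 'g set \<Rightarrow> 'g set \<Rightarrow> 'g set" where
  "commutator_subgroup G H K =
     generate G {h \<otimes>\<^bsub>G\<^esub> k \<otimes>\<^bsub>G\<^esub> inv\<^bsub>G\<^esub> h \<otimes>\<^bsub>G\<^esub> inv\<^bsub>G\<^esub> k | h k. h \<in> H \<and> k \<in> K}"

text \<open>The normal closure of \<open>H\<close> in the subgroup \<open>K\<close> of \<open>G\<close>.\<close>

definition normal_closure_in :: "('g, 'b) monoid_scheme \<Rightarrow> 'g set \<Rightarrow> 'g set \<Rightarrow> 'g set" where
  "normal_closure_in G K H = \<Inter>{N. N \<lhd> (G\<lparr>carrier := K\<rparr>) \<and> H \<subseteq> N}"

section \<open>General linear groups and their subgroups\<close>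

text \<open>
  Matrices over a ring record, so that the same definition serves the ring \<open>'a\<close> (wrapped as
  \<open>ring_of_type_algebra\<close>) and its quotients \<open>ring_of_type_algebra Quot I\<close>.
\<close>

definition matrix_monoid :: "('r, 'b) ring_scheme \<Rightarrow> ('r^'n^'n) monoid" where
  "matrix_monoid S =
     \<lparr>carrier = {A. \<forall>i j. A $ i $ j \<in> carrier S},
      monoid.mult = (\<lambda>A B. \<chi> i j. \<Oplus>\<^bsub>S\<^esub> k\<in>UNIV. A $ i $ k \<otimes>\<^bsub>S\<^esub> B $ k $ j),
      one = (\<chi> i j. if i = j then \<one>\<^bsub>S\<^esub> else \<zero>\<^bsub>S\<^esub>)\<rparr>"

definition GL :: "('r, 'b) ring_scheme \<Rightarrow> ('r^'n^'n) monoid" where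
  "GL S = units_of (matrix_monoid S)"

abbreviation GL_type :: "('a::ring_1^'n^'n) monoid" where
  "GL_type \<equiv> GL ring_of_type_algebra"

definition transvection :: "'n \<Rightarrow> 'n \<Rightarrow> 'a::ring_1 \<Rightarrow> 'a^'n^'n" where
  "transvection i j x = mat 1 + (\<chi> k l. if k = i \<and> l = j then x else 0)"

definition elementary :: "'a::ring_1 set \<Rightarrow> ('a^'n^'n) set" where
  "elementary I = generate GL_type {transvection i j x | i j x. i \<noteq> j \<and> x \<in> I}"

definition relative_elementary :: "'a::ring_1 set \<Rightarrow> ('a^'n^'n) set" where
  "relative_elementary I = normal_closure_in GL_type (elementary UNIV) (elementary I)"

definition reduce_matrix :: "'a::ring_1 set \<Rightarrow> 'a^'n^'n \<Rightarrow> 'a set^'n^'n" where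
  "reduce_matrix I A = (\<chi> i j. I +>\<^bsub>ring_of_type_algebra\<^esub> (A $ i $ j))"

definition full_congruence :: "'a::ring_1 set \<Rightarrow> ('a^'n^'n) set" where
  "full_congruence I =
     {g \<in> carrier GL_type. reduce_matrix I g \<in> group_center (GL (ring_of_type_algebra Quot I))}"

end

theory Submission
  imports Defs
begin

unbundle no fps_syntax

text \<open>
  For \<open>g\<close> in the full congruence subgroup let \<open>u\<close> be the \<open>i\<close>-th column of \<open>g\<close> and \<open>v\<close> the
  \<open>j\<close>-th row of its inverse. Then \<open>v u = 0\<close>, the conjugate of \<open>t\<^sub>i\<^sub>j(x)\<close> by \<open>g\<close> is \<open>1 + u x v\<close>, and
  \<open>x \<mapsto> 1 + u x v\<close> turns sums into products. Since \<open>v\<close> is unimodular, the exchange property yields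
  idempotents \<open>e\<^sub>k = v\<^sub>k r\<^sub>k\<close> with sum 1. Because \<open>e\<^sub>k v\<^sub>l = e\<^sub>k v\<^sub>k r\<^sub>k v\<^sub>l\<close>, elementary
  column operations reduce the row \<open>e\<^sub>k v\<close> to its \<open>k\<close>-th entry, and a matrix \<open>1 + a z\<close> with \<open>z a = 0\<close>
  and a row \<open>z\<close> supported at one position is an explicit product of transvections and one commutator of transvections.
  Splitting \<open>x = \<Sum>\<^sub>k x e\<^sub>k\<close> expresses the conjugate as a product of such matrices.
\<close>

section \<open>Idempotents in exchange rings\<close>

text \<open>Terms outside the support are zero, so summing over the support and over
  \<open>\<Lambda>\<close> gives the same value. With finite support automatic, the direct sums
  below are handled through plain finite sums.\<close>

lemma is_direct_sum_finite:
  assumes "abelian_group U" "finite \<Lambda>"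
  shows "is_direct_sum U \<Lambda> N \<longleftrightarrow>
    (\<forall>i\<in>\<Lambda>. submodule (N i) ring_of_type_algebra U) \<and>
    (\<forall>x\<in>carrier U. \<exists>!f. f \<in> (\<Pi>\<^sub>E i\<in>\<Lambda>. N i) \<and> x = finsum U f \<Lambda>)"
proof -
  interpret abelian_group U by fact
  have *: "finsum U f {i\<in>\<Lambda>. f i \<noteq> \<zero>\<^bsub>U\<^esub>} = finsum U f \<Lambda>"
    if "\<forall>i\<in>\<Lambda>. submodule (N i) ring_of_type_algebra U" "f \<in> (\<Pi>\<^sub>E i\<in>\<Lambda>. N i)" for f
  proof -
    have "f \<in> \<Lambda> \<rightarrow> carrier U"
      using that by (fastforce simp: submodule_def subgroup_def)
    then show ?thesis
      using \<open>finite \<Lambda>\<close> by (intro add.finprod_mono_neutral_cong_left) auto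
  qed
  show ?thesis
    unfolding is_direct_sum_def using \<open>finite \<Lambda>\<close> * by (auto cong: conj_cong)
qed

text \<open>The free left module of rank \<open>n\<close>, realised inside the type of sequences
  over which \<open>exchange_ring\<close> quantifies.\<close>

definition finite_sequences :: "nat \<Rightarrow> ('a::ring_1, nat \<Rightarrow> 'a) module" where
  "finite_sequences n =
     \<lparr>carrier = {f. \<forall>i\<ge>n. f i = 0}, monoid.mult = (\<lambda>f g. f), one = (\<lambda>_. 0), zero = (\<lambda>_. 0),
      add = (\<lambda>f g i. f i + g i), module.smult = (\<lambda>r f i. r * f i)\<rparr>"

lemma finite_sequences_simps [simp]:
  "carrier (finite_sequences n) = {f. \<forall>i\<ge>n. f i = 0}"
  "zero (finite_sequences n) = (\<lambda>_. 0)"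
  "add (finite_sequences n) f g = (\<lambda>i. f i + g i)"
  "module.smult (finite_sequences n) r f = (\<lambda>i. r * f i)"
  by (simp_all add: finite_sequences_def)

lemma left_module_finite_sequences:
  "left_module (finite_sequences n :: ('a::ring_1, nat \<Rightarrow> 'a) module)"
proof -
  have "abelian_group (finite_sequences n :: ('a, nat \<Rightarrow> 'a) module)"
  proof (rule abelian_groupI)
    fix x :: "nat \<Rightarrow> 'a" assume "x \<in> carrier (finite_sequences n)"
    then show "\<exists>y\<in>carrier (finite_sequences n). y \<oplus>\<^bsub>finite_sequences n\<^esub> x = \<zero>\<^bsub>finite_sequences n\<^esub>"
      by (intro bexI[of _ "\<lambda>i. - x i"]) auto
  qed (auto simp: algebra_simps)
  then show ?thesis
    by (auto simp: left_module_def left_module_axioms_def algebra_simps)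
qed

lemmas abelian_group_finite_sequences =
  left_module.axioms(1)[OF left_module_finite_sequences]

lemma finsum_finite_sequences:
  fixes F :: "'b \<Rightarrow> nat \<Rightarrow> 'a::ring_1"
  assumes "finite A" "F \<in> A \<rightarrow> carrier (finite_sequences n)"
  shows "finsum (finite_sequences n) F A = (\<lambda>i. \<Sum>a\<in>A. F a i)"
proof -
  interpret abelian_group "finite_sequences n :: ('a, nat \<Rightarrow> 'a) module"
    by (rule abelian_group_finite_sequences)
  show ?thesis
    using assms by (induction A rule: finite_induct) (auto simp: Pi_iff)
qed

lemma submodule_finite_sequencesI:
  fixes H :: "(nat \<Rightarrow> 'a::ring_1) set"
  assumes "H \<subseteq> carrier (finite_sequences n)" "(\<lambda>_. 0) \<in> H"
    and add: "\<And>f g. f \<in> H \<Longrightarrow> g \<in> H \<Longrightarrow> (\<lambda>i. f i + g i) \<in> H"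
    and smult: "\<And>r f. f \<in> H \<Longrightarrow> (\<lambda>i. r * f i) \<in> H"
  shows "submodule H ring_of_type_algebra (finite_sequences n)"
proof -
  interpret abelian_group "finite_sequences n :: ('a, nat \<Rightarrow> 'a) module"
    by (rule abelian_group_finite_sequences)
  have "\<ominus>\<^bsub>finite_sequences n\<^esub> f = (\<lambda>i. - f i)" if "f \<in> H" for f
    using that assms(1) by (intro minus_equality) auto
  \<comment> \<open>Negation is scalar multiplication by \<open>- 1\<close>, so closure under
    scalars supplies the additive inverses.\<close>
  then have "inv\<^bsub>add_monoid (finite_sequences n)\<^esub> f \<in> H" if "f \<in> H" for f
    using smult[OF that, of "- 1"] that by (simp add: a_inv_def)
  then show ?thesis
    using assms by (auto simp: submodule_def subgroup_def submodule_axioms_def)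
qed

lemma submodule_finite_sequencesD:
  assumes "submodule H ring_of_type_algebra (finite_sequences n :: ('a::ring_1, nat \<Rightarrow> 'a) module)"
  shows "H \<subseteq> {f. \<forall>i\<ge>n. f i = 0}" "(\<lambda>_. 0) \<in> H" "f \<in> H \<Longrightarrow> g \<in> H \<Longrightarrow> (\<lambda>i. f i + g i) \<in> H"
    "f \<in> H \<Longrightarrow> (\<lambda>i. r * f i) \<in> H"
  using assms by (auto simp: submodule_def subgroup_def submodule_axioms_def ring_of_type_algebra_def)

lemma finsum_PiE_finite_sequences:
  assumes "finite \<Lambda>" "\<forall>p\<in>\<Lambda>. N p \<subseteq> carrier (finite_sequences n)"
    "f \<in> (\<Pi>\<^sub>E p\<in>\<Lambda>. N p)"
  shows "finsum (finite_sequences n) f \<Lambda> = (\<lambda>i. \<Sum>p\<in>\<Lambda>. f p i)"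
  using assms by (intro finsum_finite_sequences) fastforce+

lemma is_direct_sum_finite_sequencesI:
  assumes "finite \<Lambda>" "\<And>p. p \<in> \<Lambda> \<Longrightarrow> submodule (N p) ring_of_type_algebra (finite_sequences n)"
    "\<And>x. x \<in> carrier (finite_sequences n) \<Longrightarrow>
      \<exists>!f. f \<in> (\<Pi>\<^sub>E p\<in>\<Lambda>. N p) \<and> x = finsum (finite_sequences n) f \<Lambda>"
  shows "is_direct_sum (finite_sequences n) \<Lambda> N"
  using assms by (subst is_direct_sum_finite[OF abelian_group_finite_sequences]) blast+

text \<open>\<open>exchange_property\<close> takes its index sets from the type of the module
  elements, so the basis vectors themselves serve as indices of the coordinate axes.\<close>

definition unit_sequence :: "nat \<Rightarrow> nat \<Rightarrow> 'a::ring_1" where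
  "unit_sequence k = (\<lambda>i. if i = k then 1 else 0)"

lemma inj_unit_sequence: "inj_on unit_sequence A"
  by (rule inj_onI) (metis unit_sequence_def zero_neq_one)

text \<open>A sequence that vanishes wherever the basis vector \<open>p\<close> vanishes lies on the
  axis through \<open>p\<close>. In a sum of such vectors only the \<open>i\<close>-th axis
  contributes to the \<open>i\<close>-th coordinate, which determines every component.\<close>

lemma direct_sum_coordinates:
  fixes n :: nat
  shows "is_direct_sum (finite_sequences n) (unit_sequence ` {..<n} :: (nat \<Rightarrow> 'a) set)
     (\<lambda>p. {f. \<forall>i. i \<ge> n \<or> p i = 0 \<longrightarrow> f i = (0::'a::ring_1)})"
proof -
  let ?\<Lambda> = "unit_sequence ` {..<n} :: (nat \<Rightarrow> 'a) set"
  let ?N = "\<lambda>p :: nat \<Rightarrow> 'a. {f. \<forall>i. i \<ge> n \<or> p i = 0 \<longrightarrow> f i = (0::'a)}"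
  have sum: "finsum (finite_sequences n) f ?\<Lambda> = (\<lambda>i. if i < n then f (unit_sequence i) i else 0)"
    if f: "f \<in> (\<Pi>\<^sub>E p\<in>?\<Lambda>. ?N p)" for f
  proof
    fix i
    have z: "f (unit_sequence k) i = 0" if "k < n" "i \<noteq> k \<or> i \<ge> n" for k
      using that PiE_mem[OF f, of "unit_sequence k"] by (auto simp: unit_sequence_def)
    have "finsum (finite_sequences n) f ?\<Lambda> i = (\<Sum>p\<in>?\<Lambda>. f p i)"
      using f by (subst finsum_PiE_finite_sequences[where N = ?N]) auto
    also have "\<dots> = (\<Sum>k<n. f (unit_sequence k) i)"
      by (subst sum.reindex[OF inj_unit_sequence]) simp
    also have "\<dots> = (\<Sum>k<n. if k = i then f (unit_sequence i) i else 0)"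
      using z by (intro sum.cong) auto
    finally show "finsum (finite_sequences n) f ?\<Lambda> i = (if i < n then f (unit_sequence i) i else 0)"
      by simp
  qed
  have ex1: "\<exists>!f. f \<in> (\<Pi>\<^sub>E p\<in>?\<Lambda>. ?N p) \<and> x = finsum (finite_sequences n) f ?\<Lambda>"
    if x: "x \<in> carrier (finite_sequences n)" for x :: "nat \<Rightarrow> 'a"
  proof (rule ex1I)
    let ?f = "\<lambda>p\<in>?\<Lambda>. \<lambda>i. if p i = 0 then 0 else x i"
    have f: "?f \<in> (\<Pi>\<^sub>E p\<in>?\<Lambda>. ?N p)" using x by auto
    moreover have "x = finsum (finite_sequences n) ?f ?\<Lambda>"
      unfolding sum[OF f] using x by (auto simp: fun_eq_iff unit_sequence_def)
    ultimately show "?f \<in> (\<Pi>\<^sub>E p\<in>?\<Lambda>. ?N p) \<and> x = finsum (finite_sequences n) ?f ?\<Lambda>" by simp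
  next
    fix g assume g: "g \<in> (\<Pi>\<^sub>E p\<in>?\<Lambda>. ?N p) \<and> x = finsum (finite_sequences n) g ?\<Lambda>"
    have "g p i = (if p i = 0 then 0 else x i)" if p: "p \<in> ?\<Lambda>" for p i
    proof -
      obtain k where k: "k < n" "p = unit_sequence k" using p by auto
      have x: "x i = (if i < n then g (unit_sequence i) i else 0)"
        using fun_cong[OF sum[OF conjunct1[OF g]], of i] conjunct2[OF g] by simp
      have "p i = 0 \<Longrightarrow> g p i = 0" "i \<ge> n \<Longrightarrow> g p i = 0"
        using PiE_mem[OF conjunct1[OF g] p] by auto
      then show ?thesis
        using k x by (auto simp: unit_sequence_def)
    qed
    then show "g = (\<lambda>p\<in>?\<Lambda>. \<lambda>i. if p i = 0 then 0 else x i)"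
      using g by (intro PiE_ext[of g ?\<Lambda> ?N]) (auto simp: fun_eq_iff PiE_iff)
  qed
  have "submodule (?N p) ring_of_type_algebra (finite_sequences n)" for p :: "nat \<Rightarrow> 'a"
    by (rule submodule_finite_sequencesI) auto
  then show ?thesis
    by (intro is_direct_sum_finite_sequencesI ex1) auto
qed

section \<open>Unimodular rows and the direct summands they span\<close>

context
  fixes n :: nat and b c :: "nat \<Rightarrow> 'a::ring_1"
  assumes bc: "(\<Sum>i<n. b i * c i) = 1" and b: "\<And>i. i \<ge> n \<Longrightarrow> b i = 0"
begin

private lemma sum_mult_c: "(\<Sum>i<n. r * b i * c i) = r"
  using bc by (simp add: mult.assoc flip: sum_distrib_left)

text \<open>The functional with value \<open>\<Sum>i<n. f i * c i\<close> at \<open>f\<close> is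
  left linear and sends \<open>r * b\<close> to \<open>r\<close>. It therefore splits the map from
  \<open>r\<close> to \<open>r * b\<close>, and its kernel is the complement: if \<open>s\<close> is
  the value at \<open>x\<close>, the components of \<open>x\<close> are \<open>s * b\<close> and
  \<open>x - s * b\<close>.\<close>

lemma direct_sum_unimodular_row:
  "is_direct_sum (finite_sequences n) (UNIV :: bool set)
     (\<lambda>d. if d then range (\<lambda>r i. r * b i) else {f. (\<forall>i\<ge>n. f i = 0) \<and> (\<Sum>i<n. f i * c i) = 0})"
  (is "is_direct_sum _ _ ?N")
proof -
  have sum: "finsum (finite_sequences n) f UNIV = (\<lambda>i. f True i + f False i)"
    if f: "f \<in> (\<Pi>\<^sub>E d\<in>UNIV. ?N d)" for f
  proof -
    have "finsum (finite_sequences n) f UNIV = (\<lambda>i. \<Sum>d\<in>UNIV. f d i)"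
      by (rule finsum_PiE_finite_sequences[OF _ _ f]) (use b in auto)
    then show ?thesis by (simp add: UNIV_bool add.commute)
  qed
  have ex1: "\<exists>!f. f \<in> (\<Pi>\<^sub>E p\<in>UNIV. ?N p) \<and> x = finsum (finite_sequences n) f UNIV"
    if x: "x \<in> carrier (finite_sequences n)" for x :: "nat \<Rightarrow> 'a"
  proof (rule ex1I)
    let ?s = "\<Sum>i<n. x i * c i"
    let ?f = "\<lambda>d i. if d then ?s * b i else x i - ?s * b i"
    have f: "?f \<in> (\<Pi>\<^sub>E p\<in>UNIV. ?N p)"
      using x b by (auto simp: left_diff_distrib sum_subtractf sum_mult_c)
    then show "?f \<in> (\<Pi>\<^sub>E p\<in>UNIV. ?N p) \<and> x = finsum (finite_sequences n) ?f UNIV"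
      by (simp only: sum[OF f] simp_thms) (auto simp: fun_eq_iff)
  next
    let ?s = "\<Sum>i<n. x i * c i"
    let ?f = "\<lambda>d i. if d then ?s * b i else x i - ?s * b i"
    fix g assume "g \<in> (\<Pi>\<^sub>E p\<in>UNIV. ?N p) \<and> x = finsum (finite_sequences n) g UNIV"
    then have g: "g \<in> (\<Pi>\<^sub>E p\<in>UNIV. ?N p)" and x: "x = (\<lambda>i. g True i + g False i)"
      using sum by auto
    then have "g True \<in> ?N True" "g False \<in> ?N False" by (auto simp only: PiE_iff UNIV_I)
    then obtain r where r: "g True = (\<lambda>i. r * b i)" and "(\<Sum>i<n. g False i * c i) = 0"
      by auto
    then have s: "?s = r"
      unfolding x by (simp add: distrib_right sum.distrib sum_mult_c)
    show "g = ?f"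
    proof (intro ext)
      fix d i show "g d i = ?f d i"
        unfolding s by (cases d) (simp_all add: r x)
    qed
  qed
  have "submodule (?N d) ring_of_type_algebra (finite_sequences n)" for d
  proof (rule submodule_finite_sequencesI)
    show "(\<lambda>_. 0) \<in> ?N d" by (auto intro!: image_eqI[of _ _ 0])
  next
    fix f g assume "f \<in> ?N d" "g \<in> ?N d"
    then show "(\<lambda>i. f i + g i) \<in> ?N d"
      by (cases d) (auto simp flip: distrib_right, auto simp: distrib_right sum.distrib)
  next
    fix f r assume "f \<in> ?N d"
    then show "(\<lambda>i. r * f i) \<in> ?N d"
      by (auto split: if_splits simp: mult.assoc fun_eq_iff simp flip: sum_distrib_left)
        (auto simp flip: mult.assoc)
  qed (use b in auto)
  then show ?thesis
    by (intro is_direct_sum_finite_sequencesI ex1) auto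
qed

lemma unimodular_row_isomorphic_regular:
  "left_module_isomorphic (finite_sequences n\<lparr>carrier := range (\<lambda>r i. r * b i)\<rparr>)
     regular_left_module"
  unfolding left_module_isomorphic_def
proof (intro exI conjI allI ballI)
  let ?f = "\<lambda>x. \<Sum>i<n. x i * c i"
  show "bij_betw ?f (carrier (finite_sequences n\<lparr>carrier := range (\<lambda>r i. r * b i)\<rparr>))
     (carrier regular_left_module)"
    by (rule bij_betw_byWitness[where f' = "\<lambda>r i. r * b i"])
      (auto simp: regular_left_module_def sum_mult_c)
qed (simp_all add: regular_left_module_def distrib_right sum.distrib mult.assoc sum_distrib_left)

end

text \<open>
  Apply the exchange property to the free module of rank \<open>n\<close>, the submodule generated by the row \<open>b\<close>
  and the coordinate axes. The \<open>k\<close>-th unit vector is \<open>r k * b\<close> modulo the exchanged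
  summands; expanding \<open>b\<close> and the vectors \<open>r k * b l\<close> times the \<open>l\<close>-th unit vector shows that the
  \<open>b k * r k\<close> are orthogonal with sum 1.
\<close>

lemma exchange_ring_idempotents_nat:
  fixes b c :: "nat \<Rightarrow> 'a::ring_1"
  assumes ex: "exchange_ring TYPE('a)" and bc: "(\<Sum>i<n. b i * c i) = 1"
    and b: "\<And>i. i \<ge> n \<Longrightarrow> b i = 0"
  shows "\<exists>r. (\<Sum>k<n. b k * r k) = 1 \<and> (\<forall>k<n. b k * r k * (b k * r k) = b k * r k)"
proof -
  let ?U = "finite_sequences n :: ('a, nat \<Rightarrow> 'a) module"
  let ?M = "range (\<lambda>r i. r * b i)"
  let ?\<Lambda> = "unit_sequence ` {..<n} :: (nat \<Rightarrow> 'a) set"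
  let ?N = "\<lambda>p :: nat \<Rightarrow> 'a. {f. \<forall>i. i \<ge> n \<or> p i = 0 \<longrightarrow> f i = (0::'a)}"
  have M: "is_direct_sum ?U (UNIV :: bool set)
      (\<lambda>d. if d then ?M else {f. (\<forall>i\<ge>n. f i = 0) \<and> (\<Sum>i<n. f i * c i) = 0})"
    "left_module_isomorphic (?U\<lparr>carrier := ?M\<rparr>) regular_left_module"
    by (rule direct_sum_unimodular_row unimodular_row_isomorphic_regular; (rule bc | erule b))+
  obtain N' where N': "\<forall>p\<in>?\<Lambda>. submodule (N' p) ring_of_type_algebra ?U \<and> N' p \<subseteq> ?N p"
    and ds: "is_direct_sum ?U (insert None (Some ` ?\<Lambda>)) (case_option ?M N')"
    using ex[unfolded exchange_ring_def exchange_property_def, THEN spec, THEN spec, THEN spec,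
        THEN spec, THEN spec, THEN mp, OF conjI[OF left_module_finite_sequences
          conjI[OF M(2)
            conjI[OF M(1) direct_sum_coordinates]]]]
    by (elim exE conjE)
  have N'_sub: "submodule (N' (unit_sequence k)) ring_of_type_algebra ?U" if "k < n" for k
    using bspec[OF N', of "unit_sequence k"] that by simp
  have N'_supp: "h i = 0" if "h \<in> N' (unit_sequence k)" "k < n" "i \<noteq> k \<or> i \<ge> n" for h k i
  proof -
    have "N' (unit_sequence k) \<subseteq> ?N (unit_sequence k)"
      using bspec[OF N', of "unit_sequence k"] that by simp
    from subsetD[OF this that(1)] show ?thesis
      using that by (auto simp: unit_sequence_def)
  qed
  \<comment> \<open>Since \<open>N' (unit_sequence l)\<close> lies on the \<open>l\<close>-th axis,
    it is determined by the left ideal \<open>P l\<close> of its \<open>l\<close>-th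
    coordinates.\<close>
  define P where "P l = {m. (\<lambda>i. m * unit_sequence l i) \<in> N' (unit_sequence l)}" for l
  have P_add: "x + y \<in> P l" if "x \<in> P l" "y \<in> P l" "l < n" for x y l
    using submodule_finite_sequencesD(3)[OF N'_sub, of l] that
    by (fastforce simp: P_def distrib_right)
  have P_mult: "s * x \<in> P l" if "x \<in> P l" "l < n" for x s l
    using submodule_finite_sequencesD(4)[OF N'_sub, of l _ s] that
    by (fastforce simp: P_def mult.assoc)
  have P_zero: "0 \<in> P l" if "l < n" for l
    using submodule_finite_sequencesD(2)[OF N'_sub, of l] that
    by (fastforce simp: P_def)
  have P_neg: "- x \<in> P l" if "x \<in> P l" "l < n" for x l
    using P_mult[OF that, of "-1"] by simp
  have P_sum: "(\<Sum>k\<in>A. f k) \<in> P l" if "\<And>k. k \<in> A \<Longrightarrow> f k \<in> P l" "l < n" for A f and l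
    using that by (induction A rule: infinite_finite_induct) (auto intro: P_add P_zero)

  let ?J = "insert None (Some ` ?\<Lambda>)"
  have fin: "finite ?J" by simp
  have ex1: "\<exists>!f. f \<in> (\<Pi>\<^sub>E j\<in>?J. case_option ?M N' j) \<and> x = finsum ?U f ?J" if "x \<in> carrier ?U" for x
    using ds that unfolding is_direct_sum_finite[OF abelian_group_finite_sequences fin] by blast
  have sum: "finsum ?U f ?J = (\<lambda>l. f None l + (if l < n then f (Some (unit_sequence l)) l else 0))"
    if f: "f \<in> (\<Pi>\<^sub>E j\<in>?J. case_option ?M N' j)" for f
  proof
    fix i
    have N'k: "f (Some (unit_sequence k)) \<in> N' (unit_sequence k)" if "k < n" for k
      using that PiE_mem[OF f, of "Some (unit_sequence k)"] by simp
    have z: "f (Some (unit_sequence k)) i = 0" if "k < n" "i \<noteq> k \<or> i \<ge> n" for k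
      using N'_supp N'k that by blast
    have "finsum ?U f ?J i = (\<Sum>j\<in>?J. f j i)"
    proof (subst finsum_PiE_finite_sequences[OF fin _ f])
      show "\<forall>p\<in>?J. case_option ?M N' p \<subseteq> carrier ?U"
        using b N'_supp by auto
    qed simp
    also have "\<dots> = f None i + (\<Sum>j\<in>Some ` ?\<Lambda>. f j i)"
      by (subst sum.insert) auto
    also have "(\<Sum>j\<in>Some ` ?\<Lambda>. f j i) = (\<Sum>k<n. f (Some (unit_sequence k)) i)"
      by (simp add: sum.reindex[OF inj_unit_sequence] sum.reindex)
    also have "\<dots> = (\<Sum>k<n. if k = i then f (Some (unit_sequence i)) i else 0)"
      using z by (intro sum.cong) auto
    finally show "finsum ?U f ?J i = f None i + (if i < n then f (Some (unit_sequence i)) i else 0)"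
      by simp
  qed

  \<comment> \<open>The direct sum is now read in coordinates: existence for the unit vectors here,
    uniqueness for the zero vector next.\<close>
  have decomposition: "\<exists>r m. (\<forall>l<n. m l \<in> P l) \<and> (\<forall>l<n. unit_sequence k l = r * b l + m l)" if "k < n" for k
  proof -
    have "unit_sequence k \<in> carrier ?U" using that by (auto simp: unit_sequence_def)
    from ex1_implies_ex[OF ex1[OF this]]
    obtain f where f: "f \<in> (\<Pi>\<^sub>E j\<in>?J. case_option ?M N' j)" and u: "unit_sequence k = finsum ?U f ?J"
      by (elim exE conjE)
    obtain r where r: "f None = (\<lambda>i. r * b i)"
      using PiE_mem[OF f, of None] by auto
    have "f (Some (unit_sequence l)) l \<in> P l" if l: "l < n" for l
    proof -
      have *: "f (Some (unit_sequence l)) \<in> N' (unit_sequence l)"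
        using l PiE_mem[OF f, of "Some (unit_sequence l)"] by simp
      have "f (Some (unit_sequence l)) = (\<lambda>i. f (Some (unit_sequence l)) l * unit_sequence l i)"
        using N'_supp[OF * l] by (auto simp: unit_sequence_def fun_eq_iff)
      with * show ?thesis by (simp add: P_def)
    qed
    then show ?thesis
      using u unfolding sum[OF f] r
      by (intro exI[of _ r] exI[of _ "\<lambda>l. f (Some (unit_sequence l)) l"]) auto
  qed
  have uniqueness: "r = 0" if m: "\<And>l. l < n \<Longrightarrow> m l \<in> P l" and eq: "\<And>l. l < n \<Longrightarrow> r * b l + m l = 0" for r m
  proof -
    \<comment> \<open>Indices are basis vectors, and \<open>?k\<close> recovers the position from
      the vector. The families \<open>?f\<close> and \<open>?g\<close> both sum to zero, so they
      agree; the component at \<open>None\<close> gives \<open>r * b = 0\<close>, and pairing with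
      \<open>c\<close> gives \<open>r = 0\<close>.\<close>
    let ?k = "inv_into {..<n} unit_sequence :: (nat \<Rightarrow> 'a) \<Rightarrow> nat"
    have k: "?k (unit_sequence l) = l" if "l < n" for l
      using that by (simp add: inv_into_f_f[OF inj_unit_sequence])
    let ?f = "\<lambda>j\<in>?J. case j of None \<Rightarrow> (\<lambda>i. r * b i) | Some p \<Rightarrow> (\<lambda>i. m (?k p) * p i)"
    have f: "?f \<in> (\<Pi>\<^sub>E j\<in>?J. case_option ?M N' j)"
      using m by (auto simp: P_def k)
    let ?g = "\<lambda>j\<in>?J. \<lambda>_. 0 :: 'a"
    have g: "?g \<in> (\<Pi>\<^sub>E j\<in>?J. case_option ?M N' j)"
      using submodule_finite_sequencesD(2)[OF N'_sub]
      by (auto intro: image_eqI[of _ _ 0] simp: PiE_iff)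
    have F: "finsum ?U ?f ?J = (\<lambda>_. 0)"
    proof -
      have "m (?k (unit_sequence i)) * unit_sequence i i = m i" if "i < n" for i
        using that by (simp only: k) (simp add: unit_sequence_def)
      then show ?thesis
        unfolding sum[OF f] using eq b by (auto simp: fun_eq_iff)
    qed
    have G: "finsum ?U ?g ?J = (\<lambda>_. 0)"
      unfolding sum[OF g] by (auto simp: fun_eq_iff)
    have "?f = ?g"
    proof -
      have "(\<lambda>_. 0) \<in> carrier ?U" by simp
      then show ?thesis
      proof (rule ex1E[OF ex1])
        fix h assume "\<forall>f. f \<in> (\<Pi>\<^sub>E j\<in>?J. case_option ?M N' j) \<and> (\<lambda>_. 0) = finsum ?U f ?J \<longrightarrow> f = h"
        note h = mp[OF spec[OF this]]
        show ?thesis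
          using h[OF conjI[OF f F[symmetric]]] h[OF conjI[OF g G[symmetric]]] by (rule trans[OF _ sym])
      qed
    qed
    from fun_cong[OF this, of None] have "(\<lambda>i. r * b i) = (\<lambda>_. 0)" by simp
    then have "(\<Sum>i<n. r * b i * c i) = 0" by (simp add: fun_eq_iff)
    then show "r = 0" using bc by (simp add: mult.assoc flip: sum_distrib_left)
  qed

  obtain r m where m: "\<And>k l. k < n \<Longrightarrow> l < n \<Longrightarrow> m k l \<in> P l"
    and eq: "\<And>k l. k < n \<Longrightarrow> l < n \<Longrightarrow> unit_sequence k l = r k * b l + m k l"
    using decomposition by metis
  \<comment> \<open>Summing \<open>b k\<close> times the \<open>k\<close>-th equation over
    \<open>k\<close> writes \<open>b\<close> as a multiple of itself plus exchanged components.
    After subtracting \<open>b\<close>, uniqueness kills the coefficient.\<close>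
  have "(\<Sum>k<n. b k * r k) - 1 = 0"
  proof (rule uniqueness)
    fix l assume l: "l < n"
    show "(\<Sum>k<n. b k * m k l) \<in> P l"
      using l m by (intro P_sum P_mult) auto
    have "b l = (\<Sum>k<n. b k * unit_sequence k l)"
      using l by (simp add: unit_sequence_def if_distrib[of "\<lambda>x. _ * x"] cong: if_cong)
    also have "\<dots> = (\<Sum>k<n. b k * r k * b l + b k * m k l)"
      using l eq by (intro sum.cong) (auto simp: distrib_left mult.assoc)
    finally have "(\<Sum>k<n. b k * r k) * b l + (\<Sum>k<n. b k * m k l) = b l"
      by (simp add: sum.distrib sum_distrib_right)
    then show "((\<Sum>k<n. b k * r k) - 1) * b l + (\<Sum>k<n. b k * m k l) = 0"
      by (simp add: left_diff_distrib diff_add_eq)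
  qed
  then have one: "(\<Sum>k<n. b k * r k) = 1" by simp
  \<comment> \<open>The \<open>k\<close>-th equation at position \<open>l\<close> puts
    \<open>r k * b l\<close> into \<open>P l\<close>, so the corresponding multiple of the
    \<open>l\<close>-th unit vector lies in the exchanged summands. Multiplying the
    \<open>l\<close>-th equation by \<open>r k * b l\<close> from the left thus decomposes zero with
    coefficient \<open>r k * b l * r l\<close>.\<close>
  have orth: "r k * b l * r l = 0" if "k < n" "l < n" "k \<noteq> l" for k l
  proof (rule uniqueness)
    fix i assume i: "i < n"
    have "r k * b l = - m k l"
      using eq[OF that(1,2)] that(3) by (simp add: unit_sequence_def eq_neg_iff_add_eq_0)
    then have "r k * b l \<in> P l"
      using P_neg m that by metis
    then have "unit_sequence l i * (r k * b l) \<in> P i"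
      using P_zero i by (auto simp: unit_sequence_def)
    then show "r k * b l * m l i + - (unit_sequence l i * (r k * b l)) \<in> P i"
      using P_add[OF P_mult[OF m[OF that(2) i] i] P_neg[OF _ i] i] by blast
    have "r k * b l * unit_sequence l i = r k * b l * (r l * b i + m l i)"
      using eq that i by simp
    then show "r k * b l * r l * b i + (r k * b l * m l i + - (unit_sequence l i * (r k * b l))) = 0"
      by (simp add: unit_sequence_def distrib_left mult.assoc split: if_splits)
  qed
  have "b k * r k * (b k * r k) = b k * r k" if k: "k < n" for k
  proof -
    have "b k * r k = b k * r k * (\<Sum>l<n. b l * r l)" by (simp add: one)
    also have "\<dots> = (\<Sum>l<n. if l = k then b k * r k * (b k * r k) else 0)"
      unfolding sum_distrib_left using orth[OF k] by (intro sum.cong) (auto simp: mult.assoc)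
    finally show ?thesis using k by simp
  qed
  with one show ?thesis by blast
qed

lemma exchange_ring_idempotents:
  fixes b c :: "'n::finite \<Rightarrow> 'a::ring_1"
  assumes ex: "exchange_ring TYPE('a)" and bc: "(\<Sum>i\<in>UNIV. b i * c i) = 1"
  shows "\<exists>r. (\<Sum>k\<in>UNIV. b k * r k) = 1 \<and> (\<forall>k. b k * r k * (b k * r k) = b k * r k)"
proof -
  obtain h where h: "bij_betw h {..<CARD('n)} (UNIV :: 'n set)"
    using ex_bij_betw_nat_finite[of "UNIV :: 'n set"] by (auto simp: atLeast0LessThan)
  let ?n = "CARD('n)"
  have sum: "(\<Sum>i<?n. f (h i)) = (\<Sum>i\<in>UNIV. f i)" for f :: "'n \<Rightarrow> 'a"
    by (rule sum.reindex_bij_betw[OF h])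
  \<comment> \<open>Extension by 0 beyond \<open>CARD('n)\<close> keeps the row inside the free
    module of that rank.\<close>
  let ?b = "\<lambda>i. if i < ?n then b (h i) else 0"
  have "(\<Sum>i<?n. ?b i * c (h i)) = (\<Sum>i<?n. b (h i) * c (h i))" by simp
  also have "\<dots> = 1" using sum[of "\<lambda>i. b i * c i"] bc by simp
  finally obtain r where r: "(\<Sum>k<?n. ?b k * r k) = 1"
    "\<forall>k<?n. ?b k * r k * (?b k * r k) = ?b k * r k"
    using exchange_ring_idempotents_nat[OF ex, where n = ?n and b = ?b and c = "\<lambda>i. c (h i)"] by auto
  let ?h = "inv_into {..<?n} h"
  have hh: "?h (h k) = k" if "k < ?n" for k
    using that h by (simp add: bij_betw_inv_into_left)
  have hh': "h (?h k) = k" "?h k < ?n" for k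
    using h bij_betw_inv_into_right[OF h, of k] bij_betwE[OF bij_betw_inv_into[OF h]] by auto
  show ?thesis
  proof (intro exI[of _ "\<lambda>k. r (?h k)"] conjI allI)
    show "(\<Sum>k\<in>UNIV. b k * r (?h k)) = 1"
      using r(1) by (simp add: hh flip: sum)
    show "b k * r (?h k) * (b k * r (?h k)) = b k * r (?h k)" for k
      using r(2)[rule_format, OF hh'(2)[of k]] hh' by simp
  qed
qed

section \<open>Normal closures and commutators\<close>

context group
begin

text \<open>Inverses in the restricted record agree with those of \<open>G\<close>, so normality in
  \<open>K\<close> can be tested by computing in \<open>G\<close>.\<close>

lemma normal_in_subgroup_iff:
  assumes K: "subgroup K G"
  shows "N \<lhd> (G\<lparr>carrier := K\<rparr>) \<longleftrightarrow>
    subgroup N G \<and> N \<subseteq> K \<and> (\<forall>x\<in>K. \<forall>h\<in>N. x \<otimes> h \<otimes> inv x \<in> N)"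
proof -
  interpret K: group "G\<lparr>carrier := K\<rparr>" by (rule subgroup_imp_group[OF K])
  have "subgroup N (G\<lparr>carrier := K\<rparr>) \<longleftrightarrow> subgroup N G \<and> N \<subseteq> K"
    using incl_subgroup[OF K] subgroup_incl[OF _ K] subgroup.subset[of N "G\<lparr>carrier := K\<rparr>"] by auto
  then show ?thesis
    unfolding K.normal_inv_iff by (auto simp: m_inv_consistent[OF K])
qed

lemma normal_closure_in:
  assumes K: "subgroup K G" and H: "H \<subseteq> K"
  shows normal_closure_in_normal: "normal_closure_in G K H \<lhd> (G\<lparr>carrier := K\<rparr>)"
    and normal_closure_in_superset: "H \<subseteq> normal_closure_in G K H"
    and normal_closure_in_least:
      "N \<lhd> (G\<lparr>carrier := K\<rparr>) \<Longrightarrow> H \<subseteq> N \<Longrightarrow> normal_closure_in G K H \<subseteq> N"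
proof -
  let ?A = "{N. N \<lhd> (G\<lparr>carrier := K\<rparr>) \<and> H \<subseteq> N}"
  \<comment> \<open>The family contains \<open>K\<close>, so the intersection is over a nonempty
    family and stays inside \<open>K\<close>.\<close>
  have "K \<lhd> (G\<lparr>carrier := K\<rparr>)"
    unfolding normal_in_subgroup_iff[OF K] using K
    by (auto intro!: subgroup.m_closed subgroup.m_inv_closed)
  then have "K \<in> ?A" using H by simp
  then have "subgroup (\<Inter>?A) G" "\<Inter>?A \<subseteq> K"
    by (auto intro!: subgroups_Inter simp: normal_in_subgroup_iff[OF K])
  then show "normal_closure_in G K H \<lhd> (G\<lparr>carrier := K\<rparr>)"
    unfolding normal_closure_in_def normal_in_subgroup_iff[OF K] by auto
qed (auto simp: normal_closure_in_def)

text \<open>Conjugation by an element of \<open>K\<close> turns the commutator of \<open>h\<close>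
  and \<open>k\<close> into that of their conjugates, which remain in \<open>K\<close> and
  \<open>N\<close>. So the generating set is already stable under conjugation.\<close>

lemma normal_commutator_subgroup:
  assumes K: "subgroup K G" and N: "N \<lhd> (G\<lparr>carrier := K\<rparr>)"
  shows "commutator_subgroup G K N \<lhd> (G\<lparr>carrier := K\<rparr>)" "commutator_subgroup G K N \<subseteq> N"
proof -
  interpret K: group "G\<lparr>carrier := K\<rparr>" by (rule subgroup_imp_group[OF K])
  let ?S = "{h \<otimes> k \<otimes> inv h \<otimes> inv k | h k. h \<in> K \<and> k \<in> N}"
  note N[unfolded normal_in_subgroup_iff[OF K]]
  then have sub: "subgroup N G" "N \<subseteq> K"
    and conj: "\<And>x h. x \<in> K \<Longrightarrow> h \<in> N \<Longrightarrow> x \<otimes> h \<otimes> inv x \<in> N" by blast+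
  have SN: "?S \<subseteq> N"
    using conj subgroup.m_closed[OF sub(1)] subgroup.m_inv_closed[OF sub(1)] by blast
  then show "commutator_subgroup G K N \<subseteq> N"
    unfolding commutator_subgroup_def by (rule generate_subgroup_incl[OF _ sub(1)])
  have "generate (G\<lparr>carrier := K\<rparr>) ?S \<lhd> (G\<lparr>carrier := K\<rparr>)"
  proof (rule K.normal_generateI)
    show "?S \<subseteq> carrier (G\<lparr>carrier := K\<rparr>)" using SN sub by auto
  next
    fix s g assume "s \<in> ?S" "g \<in> carrier (G\<lparr>carrier := K\<rparr>)"
    then obtain h k where s: "s = h \<otimes> k \<otimes> inv h \<otimes> inv k" "h \<in> K" "k \<in> N" and g: "g \<in> K" by auto
    have [simp]: "h \<in> carrier G" "k \<in> carrier G" "g \<in> carrier G"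
      using s g sub subgroup.subset[OF K] by auto
    have [simp]: "inv g \<otimes> (g \<otimes> x) = x" if "x \<in> carrier G" for x
      using that by (simp add: m_assoc[symmetric])
    let ?h = "g \<otimes> h \<otimes> inv g" and ?k = "g \<otimes> k \<otimes> inv g"
    have "g \<otimes> s \<otimes> inv g = ?h \<otimes> ?k \<otimes> inv ?h \<otimes> inv ?k"
      unfolding s by (simp add: m_assoc inv_mult_group)
    moreover have "?h \<in> K" "?k \<in> N"
      using s g conj K by (auto intro!: subgroup.m_closed[OF K] subgroup.m_inv_closed[OF K])
    ultimately show "g \<otimes>\<^bsub>G\<lparr>carrier := K\<rparr>\<^esub> s \<otimes>\<^bsub>G\<lparr>carrier := K\<rparr>\<^esub> inv\<^bsub>G\<lparr>carrier := K\<rparr>\<^esub> g \<in> ?S"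
      by (auto simp: m_inv_consistent[OF K g])
  qed
  then show "commutator_subgroup G K N \<lhd> (G\<lparr>carrier := K\<rparr>)"
    unfolding commutator_subgroup_def using generate_consistent[of ?S K] SN sub K by auto
qed

text \<open>The identities [gh,k] = g[h,k]g^-1 [g,k] and [g^-1,k] = g^-1 [g,k]^-1 g reduce
  membership to generators. The element \<open>k\<close> may lie outside
  \<open>generate G S\<close>, as elements of a full congruence subgroup can.\<close>

lemma commutator_generate_mem:
  assumes S: "S \<subseteq> carrier G" and N: "N \<lhd> (G\<lparr>carrier := generate G S\<rparr>)" and k: "k \<in> carrier G"
    and SN: "\<And>s. s \<in> S \<Longrightarrow> s \<otimes> k \<otimes> inv s \<otimes> inv k \<in> N" and h: "h \<in> generate G S"
  shows "h \<otimes> k \<otimes> inv h \<otimes> inv k \<in> N"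
proof -
  note K = generate_is_subgroup[OF S]
  have sub: "subgroup N G" and conj: "\<And>x h. x \<in> generate G S \<Longrightarrow> h \<in> N \<Longrightarrow> x \<otimes> h \<otimes> inv x \<in> N"
    using N[unfolded normal_in_subgroup_iff[OF K]] by blast+
  from h show ?thesis
  proof induction
    case one
    show ?case using k subgroup.one_closed[OF sub] by simp
  next
    case (incl h)
    then show ?case by (rule SN)
  next
    case (inv h)
    then have h: "h \<in> carrier G" and *: "inv h \<in> generate G S"
      using S by (auto intro: generate.inv)
    have "inv h \<otimes> inv (h \<otimes> k \<otimes> inv h \<otimes> inv k) \<otimes> inv (inv h) \<in> N"
      by (intro conj[OF *] subgroup.m_inv_closed[OF sub] SN inv)
    also have "inv h \<otimes> inv (h \<otimes> k \<otimes> inv h \<otimes> inv k) \<otimes> inv (inv h) = inv h \<otimes> k \<otimes> inv (inv h) \<otimes> inv k"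
      using h k by (simp add: m_assoc inv_mult_group)
    finally show ?case .
  next
    case (eng g h)
    then have [simp]: "g \<in> carrier G" "h \<in> carrier G" using generate_in_carrier[OF S] by auto
    have [simp]: "inv k \<otimes> (k \<otimes> x) = x" "inv g \<otimes> (g \<otimes> x) = x" if "x \<in> carrier G" for x
      using that k by (simp_all add: m_assoc[symmetric])
    have "g \<otimes> (h \<otimes> k \<otimes> inv h \<otimes> inv k) \<otimes> inv g \<otimes> (g \<otimes> k \<otimes> inv g \<otimes> inv k) \<in> N"
      using conj[OF eng.hyps(1) eng.IH(2)] eng.IH(1) by (rule subgroup.m_closed[OF sub])
    also have "g \<otimes> (h \<otimes> k \<otimes> inv h \<otimes> inv k) \<otimes> inv g \<otimes> (g \<otimes> k \<otimes> inv g \<otimes> inv k) =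
      (g \<otimes> h) \<otimes> k \<otimes> inv (g \<otimes> h) \<otimes> inv k"
      using k by (simp add: m_assoc inv_mult_group)
    finally show ?case .
  qed
qed

end

section \<open>The general linear group over a type\<close>

lemma ring_of_type_algebra_simps [simp]:
  "carrier ring_of_type_algebra = UNIV"
  "monoid.mult ring_of_type_algebra x y = x * y"
  "one ring_of_type_algebra = 1"
  "zero ring_of_type_algebra = 0"
  "add ring_of_type_algebra x y = x + y"
  by (simp_all add: ring_of_type_algebra_def)

lemma ring_ring_of_type_algebra: "ring (ring_of_type_algebra :: 'a::ring_1 ring)"
proof -
  have "\<exists>y. y + x = 0" for x :: 'a
    by (rule exI[of _ "- x"]) simp
  then show ?thesis
    by (intro ringI abelian_groupI monoidI) (auto simp: algebra_simps)
qed

lemma finsum_ring_of_type_algebra: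
  assumes "finite A"
  shows "finsum ring_of_type_algebra f A = (\<Sum>a\<in>A. f a :: 'a::ring_1)"
proof -
  interpret ring "ring_of_type_algebra :: 'a ring" by (rule ring_ring_of_type_algebra)
  show ?thesis using assms by induction auto
qed

lemma matrix_monoid_type:
  "carrier (matrix_monoid ring_of_type_algebra) = UNIV"
  "monoid.mult (matrix_monoid ring_of_type_algebra) A B = A ** B"
  "one (matrix_monoid ring_of_type_algebra) = mat 1"
  by (simp_all add: matrix_monoid_def finsum_ring_of_type_algebra matrix_matrix_mult_def mat_def
      vec_eq_iff)

lemma GL_type_simps [simp]:
  "A \<otimes>\<^bsub>GL_type\<^esub> B = A ** B" "\<one>\<^bsub>GL_type\<^esub> = mat 1"
  by (simp_all add: GL_def units_of_def matrix_monoid_type)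

lemma carrier_GL_type: "g \<in> carrier GL_type \<longleftrightarrow> (\<exists>h. g ** h = mat 1 \<and> h ** g = mat 1)"
  by (auto simp: GL_def units_of_def matrix_monoid_type Units_def)

lemma group_GL_type: "group (GL_type :: ('a::ring_1^'n^'n) monoid)"
  unfolding GL_def
  by (rule monoid.units_group, rule monoidI) (simp_all add: matrix_monoid_type matrix_mul_assoc)

lemma inv_GL_type:
  assumes "g \<in> carrier GL_type"
  shows "g ** inv\<^bsub>GL_type\<^esub> g = mat 1" "inv\<^bsub>GL_type\<^esub> g ** g = mat 1"
  using group.r_inv[OF group_GL_type assms] group.l_inv[OF group_GL_type assms] by simp_all

lemma inv_GL_type_eqI:
  assumes "g ** h = mat 1" "h ** g = mat 1"
  shows "inv\<^bsub>GL_type\<^esub> g = h"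
  using assms by (intro group.inv_equality[OF group_GL_type]) (auto simp: carrier_GL_type)

lemma matrix_add_rdistrib:
  fixes A B :: "'a::ring_1^'n^'m" and C :: "'a^'p^'n"
  shows "(A + B) ** C = A ** C + B ** C"
  by (simp add: matrix_matrix_mult_def vec_eq_iff distrib_right sum.distrib)

section \<open>Rank one perturbations of the identity matrix\<close>

definition outer :: "'a::ring_1^'n \<Rightarrow> 'a^'n \<Rightarrow> 'a^'n^'n" where
  "outer u v = (\<chi> k l. u $ k * v $ l)"

definition dot :: "'a::ring_1^'n \<Rightarrow> 'a^'n \<Rightarrow> 'a" where
  "dot v u = (\<Sum>k\<in>UNIV. v $ k * u $ k)"

lemma axis_component [simp]: "axis k x $ l = (if l = k then x else 0)"
  by (simp add: axis_def)

lemma dot_axis [simp]: "dot (axis k x) u = x * u $ k" "dot v (axis k x) = v $ k * x"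
  by (simp_all add: dot_def if_distrib[of "\<lambda>x. x * _"] if_distrib[of "\<lambda>x. _ * x"] cong: if_cong)

lemma outer_add: "outer (u + u') v = outer u v + outer u' v" "outer u (v + v') = outer u v + outer u v'"
  by (simp_all add: outer_def vec_eq_iff algebra_simps)

lemma outer_minus: "outer (- u) v = - outer u v" "outer u (- v) = - outer u v"
  by (simp_all add: outer_def vec_eq_iff)

lemma matrix_mult_outer: "A ** outer u v = outer (A *v u) v" "outer u v ** A = outer u (v v* A)"
  by (simp_all add: outer_def vec_eq_iff matrix_matrix_mult_def matrix_vector_mult_def
      vector_matrix_mult_def sum_distrib_left sum_distrib_right mult.assoc)

lemma matrix_vector_mult_one_plus_outer:
  "((mat 1 + outer u w) *v a) $ k = a $ k + u $ k * dot w a"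
  by (simp add: matrix_vector_mult_def outer_def dot_def mat_def distrib_right sum.distrib
      sum_distrib_left mult.assoc if_distrib[of "\<lambda>x. x * _"] cong: if_cong)

lemma vector_matrix_mult_one_plus_outer:
  "(v v* (mat 1 + outer u w)) $ k = v $ k + dot v u * w $ k"
  by (simp add: vector_matrix_mult_def outer_def dot_def mat_def distrib_left sum.distrib
      sum_distrib_right mult.assoc if_distrib[of "\<lambda>x. _ * x"] cong: if_cong)

text \<open>The cross term of the product contains the scalar \<open>dot v u'\<close> between
  \<open>u\<close> and \<open>v'\<close>. The factorizations below are arranged so that this scalar
  vanishes.\<close>

lemma one_plus_outer_mult:
  assumes "dot v u' = 0"
  shows "(mat 1 + outer u v) ** (mat 1 + outer u' v') = mat 1 + outer u v + outer u' v'"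
proof -
  have "(mat 1 + outer u v) *v u' = u'"
    using assms by (simp add: vec_eq_iff matrix_vector_mult_one_plus_outer)
  then show ?thesis
    by (simp add: matrix_add_ldistrib matrix_mult_outer)
qed

lemma conj_one_plus_outer:
  fixes g g' :: "'a::ring_1^'n^'n"
  assumes "g ** g' = mat 1"
  shows "g ** (mat 1 + outer u v) ** g' = mat 1 + outer (g *v u) (v v* g')"
  using assms by (simp add: matrix_add_ldistrib matrix_add_rdistrib matrix_mult_outer)

lemma transvection_eq_outer:
  "transvection i j x = mat 1 + outer (axis i x) (axis j 1)"
  "transvection i j x = mat 1 + outer (axis i 1) (axis j x)"
  by (auto simp: transvection_def outer_def vec_eq_iff)

lemma transvection_zero [simp]: "transvection i j 0 = mat 1"
  by (simp add: transvection_def vec_eq_iff)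

lemma transvection_add:
  fixes x y :: "'a::ring_1" and i j :: "'n::finite"
  assumes "i \<noteq> j"
  shows "transvection i j x ** transvection i j y = transvection i j (x + y)"
proof -
  have "axis i x + axis i y = (axis i (x + y) :: 'a^'n)"
    by (simp add: vec_eq_iff)
  then show ?thesis
    using assms unfolding transvection_eq_outer(1)
    by (subst one_plus_outer_mult) (simp_all add: add.assoc flip: outer_add)
qed

text \<open>Conjugation by \<open>transvection i k 1\<close> changes the column
  \<open>axis k x\<close> of the second factor to \<open>axis k x + axis i x\<close> and fixes its
  row, so it only adds a factor \<open>transvection i j x\<close>.\<close>

lemma transvection_commutator:
  fixes i j k :: "'n::finite"
  assumes "i \<noteq> j" "i \<noteq> k" "j \<noteq> k"
  shows "transvection i k 1 ** transvection k j x ** transvection i k (- 1) ** transvection k j (- x)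
    = transvection i j x"
proof -
  have "transvection i k 1 ** transvection k j x ** transvection i k (- 1) =
      mat 1 + outer (transvection i k 1 *v axis k x) (axis j 1 v* transvection i k (- 1))"
    unfolding transvection_eq_outer(1)[of k]
    using assms by (intro conj_one_plus_outer) (simp add: transvection_add)
  also have "transvection i k 1 *v axis k x = axis k x + axis i x"
    using assms by (auto simp: transvection_eq_outer(1) vec_eq_iff matrix_vector_mult_one_plus_outer)
  also have "axis j 1 v* transvection i k (- 1) = axis j 1"
    using assms by (auto simp: transvection_eq_outer(1) vec_eq_iff vector_matrix_mult_one_plus_outer)
  finally have "transvection i k 1 ** transvection k j x ** transvection i k (- 1) =
      transvection i j x ** transvection k j x"
    using assms unfolding transvection_eq_outer(1)
    by (subst one_plus_outer_mult) (simp_all add: outer_add add_ac)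
  then show ?thesis
    using assms by (simp add: transvection_add flip: matrix_mul_assoc)
qed

text \<open>Enlarging the support of the row by one position multiplies by one transvection. The set
  \<open>S\<close> is kept abstract because the result serves both \<open>elementary UNIV\<close>
  and \<open>relative_elementary I\<close>.\<close>

lemma one_plus_outer_row_mem:
  fixes w :: "'a::ring_1^'n"
  assumes "mat 1 \<in> S" and mult: "\<And>A B. A \<in> S \<Longrightarrow> B \<in> S \<Longrightarrow> A ** B \<in> S"
    and w: "w $ k = 0" and S: "\<And>l. l \<noteq> k \<Longrightarrow> transvection k l (w $ l) \<in> S"
  shows "mat 1 + outer (axis k 1) w \<in> S"
proof -
  have "mat 1 + outer (axis k 1) (\<chi> l. if l \<in> T then w $ l else 0) \<in> S" for T
  proof (induction T rule: infinite_finite_induct)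
    case empty
    have "outer (axis k 1) (\<chi> l. if l \<in> {} then w $ l else 0) = 0"
      by (simp add: outer_def vec_eq_iff)
    then show ?case using assms by simp
  next
    case (insert l T)
    show ?case
    proof (cases "l = k")
      case True
      then have "(\<chi> m. if m \<in> insert l T then w $ m else 0) = (\<chi> m. if m \<in> T then w $ m else 0)"
        using w by (auto simp: vec_eq_iff)
      then show ?thesis using insert.IH by simp
    next
      case False
      have "(\<chi> m. if m \<in> insert l T then w $ m else 0) = (\<chi> m. if m \<in> T then w $ m else 0) + axis l (w $ l)"
        using insert.hyps by (auto simp: vec_eq_iff)
      then have "mat 1 + outer (axis k 1) (\<chi> m. if m \<in> insert l T then w $ m else 0) =
          (mat 1 + outer (axis k 1) (\<chi> m. if m \<in> T then w $ m else 0)) ** transvection k l (w $ l)"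
        unfolding transvection_eq_outer(2)
        by (subst one_plus_outer_mult) (simp_all add: w outer_add add.assoc)
      then show ?thesis
        using mult[OF insert.IH S[OF False]] by simp
    qed
  qed simp
  from this[of UNIV] show ?thesis by (simp add: vec_lambda_eta)
qed

lemma one_plus_outer_column_mem:
  fixes w :: "'a::ring_1^'n"
  assumes "mat 1 \<in> S" and mult: "\<And>A B. A \<in> S \<Longrightarrow> B \<in> S \<Longrightarrow> A ** B \<in> S"
    and w: "w $ k = 0" and S: "\<And>l. l \<noteq> k \<Longrightarrow> transvection l k (w $ l) \<in> S"
  shows "mat 1 + outer w (axis k 1) \<in> S"
proof -
  have "mat 1 + outer (\<chi> l. if l \<in> T then w $ l else 0) (axis k 1) \<in> S" for T
  proof (induction T rule: infinite_finite_induct)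
    case empty
    have "outer (\<chi> l. if l \<in> {} then w $ l else 0) (axis k 1) = 0"
      by (simp add: outer_def vec_eq_iff)
    then show ?case using assms by simp
  next
    case (insert l T)
    show ?case
    proof (cases "l = k")
      case True
      then have "(\<chi> m. if m \<in> insert l T then w $ m else 0) = (\<chi> m. if m \<in> T then w $ m else 0)"
        using w by (auto simp: vec_eq_iff)
      then show ?thesis using insert.IH by simp
    next
      case False
      have "(\<chi> m. if m \<in> insert l T then w $ m else 0) = axis l (w $ l) + (\<chi> m. if m \<in> T then w $ m else 0)"
        using insert.hyps by (auto simp: vec_eq_iff)
      then have "mat 1 + outer (\<chi> m. if m \<in> insert l T then w $ m else 0) (axis k 1) =
          transvection l k (w $ l) ** (mat 1 + outer (\<chi> m. if m \<in> T then w $ m else 0) (axis k 1))"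
        unfolding transvection_eq_outer(1)
        by (subst one_plus_outer_mult) (simp_all add: w outer_add add.assoc)
      then show ?thesis
        using mult[OF S[OF False] insert.IH] by simp
    qed
  qed simp
  from this[of UNIV] show ?thesis by (simp add: vec_lambda_eta)
qed

text \<open>
  Column operations with the pivot \<open>v $ k\<close> turn the row \<open>e * v\<close>, where \<open>e = v $ k * r\<close>, into one
  that is supported at \<open>k\<close>.
\<close>

lemma one_plus_outer_pivot:
  fixes a v :: "'a::ring_1^'n"
  assumes e: "e = v $ k * r" "e * e = e" and a: "\<And>l. a $ l * e = a $ l" and va: "dot v a = 0"
    and w: "w = (\<chi> l. if l = k then 0 else r * v $ l)"
    and a': "a' = (mat 1 + outer (axis k 1) w) *v a"
  shows "mat 1 + outer a v = (mat 1 + outer (axis k 1) (- w)) ** (mat 1 + outer a' (axis k (e * v $ k)))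
      ** (mat 1 + outer (axis k 1) w)"
    and "e * v $ k * a' $ k = 0"
    and "a' $ l = (if l = k then a $ k - r * v $ k * a $ k else a $ l)"
proof -
  have inverse: "(mat 1 + outer (axis k 1) (- w)) ** (mat 1 + outer (axis k 1) w) = mat 1"
    by (subst one_plus_outer_mult) (simp_all add: w outer_minus)
  have "(mat 1 + outer (axis k 1) (- w)) *v a' = a"
    unfolding a' by (simp add: matrix_vector_mul_assoc inverse)
  moreover have "outer a (axis k (e * v $ k) v* (mat 1 + outer (axis k 1) w)) = outer a v"
  proof -
    have "(axis k (e * v $ k) v* (mat 1 + outer (axis k 1) w)) $ l = e * v $ l" for l
    proof (cases "l = k")
      case False
      then have "(axis k (e * v $ k) v* (mat 1 + outer (axis k 1) w)) $ l = e * (v $ k * r) * v $ l"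
        by (simp add: vector_matrix_mult_one_plus_outer w mult.assoc)
      then show ?thesis using e by simp
    qed (simp add: vector_matrix_mult_one_plus_outer w)
    \<comment> \<open>The transformed row is \<open>e * v\<close>; its factor \<open>e\<close> is
      absorbed by the column because \<open>a $ l * e = a $ l\<close>.\<close>
    then show ?thesis
      by (simp add: outer_def vec_eq_iff a flip: mult.assoc)
  qed
  ultimately show "mat 1 + outer a v = (mat 1 + outer (axis k 1) (- w)) **
      (mat 1 + outer a' (axis k (e * v $ k))) ** (mat 1 + outer (axis k 1) w)"
    by (simp add: conj_one_plus_outer[OF inverse])
  have "dot w a = (\<Sum>l\<in>UNIV. r * (v $ l * a $ l) - (if l = k then r * v $ k * a $ k else 0))"
    unfolding dot_def w by (intro sum.cong) (auto simp: mult.assoc)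
  also have "\<dots> = r * dot v a - r * v $ k * a $ k"
    by (simp add: sum_subtractf dot_def sum_distrib_left)
  finally have "dot w a = - (r * v $ k * a $ k)" using va by simp
  then show a'_eq: "a' $ l = (if l = k then a $ k - r * v $ k * a $ k else a $ l)" for l
    by (simp add: a' matrix_vector_mult_one_plus_outer)
  have "e * v $ k * a' $ k = e * v $ k * a $ k - e * (v $ k * r) * v $ k * a $ k"
    by (simp add: a'_eq right_diff_distrib mult.assoc)
  also have "\<dots> = 0" using e by simp
  finally show "e * v $ k * a' $ k = 0" .
qed

section \<open>Elementary subgroups\<close>

lemma transvection_carrier_GL:
  assumes "i \<noteq> j"
  shows "transvection i j x \<in> carrier GL_type"
  using transvection_add[OF assms, of x "- x"] transvection_add[OF assms, of "- x" x]
  by (auto simp: carrier_GL_type)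

lemma inv_transvection:
  assumes "i \<noteq> j"
  shows "inv\<^bsub>GL_type\<^esub> (transvection i j x) = transvection i j (- x)"
  using transvection_add[OF assms, of x "- x"] transvection_add[OF assms, of "- x" x]
  by (intro inv_GL_type_eqI) auto

lemma transvections_subset_GL: "{transvection i j x | i j x. i \<noteq> j \<and> x \<in> I} \<subseteq> carrier GL_type"
  using transvection_carrier_GL by blast

lemma subgroup_elementary: "subgroup (elementary I) GL_type"
  unfolding elementary_def
  by (rule group.generate_is_subgroup[OF group_GL_type transvections_subset_GL])

lemma transvection_mem_elementary: "i \<noteq> j \<Longrightarrow> x \<in> I \<Longrightarrow> transvection i j x \<in> elementary I"
  unfolding elementary_def by (rule generate.incl) blast

lemma elementary_mono: "I \<subseteq> J \<Longrightarrow> elementary I \<subseteq> elementary J"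
  unfolding elementary_def by (rule group.mono_generate[OF group_GL_type]) blast

lemmas elementary_one = subgroup.one_closed[OF subgroup_elementary, simplified]
lemmas elementary_mult = subgroup.m_closed[OF subgroup_elementary, simplified]

lemmas normal_in_elementary_iff =
  group.normal_in_subgroup_iff[OF group_GL_type subgroup_elementary]

lemma relative_elementary:
  shows normal_relative_elementary: "relative_elementary I \<lhd> (GL_type\<lparr>carrier := elementary UNIV\<rparr>)"
    and elementary_subset_relative: "elementary I \<subseteq> relative_elementary I"
    and relative_elementary_least:
      "N \<lhd> (GL_type\<lparr>carrier := elementary UNIV\<rparr>) \<Longrightarrow> elementary I \<subseteq> N \<Longrightarrow> relative_elementary I \<subseteq> N"
  unfolding relative_elementary_def
  by (rule group.normal_closure_in[OF group_GL_type subgroup_elementary elementary_mono[OF subset_UNIV]]; assumption)+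

lemma subgroup_relative_elementary: "subgroup (relative_elementary I) GL_type"
  using normal_relative_elementary[of I] unfolding normal_in_elementary_iff by auto

lemmas relative_elementary_one = subgroup.one_closed[OF subgroup_relative_elementary, simplified]
lemmas relative_elementary_mult = subgroup.m_closed[OF subgroup_relative_elementary, simplified]

lemma relative_elementary_conj:
  assumes "g \<in> elementary UNIV" "h \<in> relative_elementary I" "g ** g' = mat 1" "g' ** g = mat 1"
  shows "g ** h ** g' \<in> relative_elementary I"
  using normal_relative_elementary[of I] assms inv_GL_type_eqI[OF assms(3,4)]
  unfolding normal_in_elementary_iff by auto

lemma transvection_mem_relative_elementary:
  "i \<noteq> j \<Longrightarrow> x \<in> I \<Longrightarrow> transvection i j x \<in> relative_elementary I"
  using elementary_subset_relative transvection_mem_elementary by blast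

lemma transvection_conj_mem_relative_elementary:
  assumes "i \<noteq> j" "h \<in> relative_elementary I"
  shows "transvection i j x ** h ** transvection i j (- x) \<in> relative_elementary I"
  using assms by (intro relative_elementary_conj)
    (simp_all add: transvection_mem_elementary transvection_add)

text \<open>A third index \<open>k\<close> makes \<open>transvection i j x\<close> the commutator of
  \<open>transvection i k 1\<close> and \<open>transvection k j x\<close>. The commutator subgroup
  is normal in \<open>elementary UNIV\<close> and so contains the normal closure of
  \<open>elementary I\<close>.\<close>

lemma relative_elementary_eq_commutator:
  assumes n: "CARD('n::finite) \<ge> 3"
  shows "(relative_elementary I :: ('a::ring_1^'n^'n) set) =
    commutator_subgroup GL_type (elementary UNIV) (relative_elementary I)"
proof
  let ?N = "relative_elementary I :: ('a^'n^'n) set"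
  note comm = group.normal_commutator_subgroup[OF group_GL_type subgroup_elementary normal_relative_elementary]
  show "commutator_subgroup GL_type (elementary UNIV) ?N \<subseteq> ?N" by (rule comm(2))
  let ?C = "commutator_subgroup GL_type (elementary UNIV) ?N"
  have "transvection i j x \<in> ?C" if ij: "i \<noteq> j" and x: "x \<in> I" for i j :: 'n and x
  proof -
    have "\<exists>k. k \<notin> {i, j}"
    proof (rule ccontr)
      assume "\<nexists>k. k \<notin> {i, j}"
      then have "UNIV = {i, j}" by auto
      then have "CARD('n) = card {i, j}" by simp
      then show False using n ij by simp
    qed
    then obtain k where k: "i \<noteq> k" "j \<noteq> k" by (metis insertCI)
    have "transvection i j x = transvection i k 1 \<otimes>\<^bsub>GL_type\<^esub> transvection k j x
      \<otimes>\<^bsub>GL_type\<^esub> inv\<^bsub>GL_type\<^esub> (transvection i k 1) \<otimes>\<^bsub>GL_type\<^esub> inv\<^bsub>GL_type\<^esub> (transvection k j x)"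
      using transvection_commutator[OF ij k, of x] k by (simp add: inv_transvection)
    then show ?thesis
      unfolding commutator_subgroup_def using k x
      by (intro generate.incl) (blast intro: transvection_mem_elementary transvection_mem_relative_elementary)
  qed
  then have "elementary I \<subseteq> ?C"
    unfolding elementary_def[of I] using comm(1)[of I]
    by (intro group.generate_subgroup_incl[OF group_GL_type]) (auto simp: normal_in_elementary_iff)
  with comm(1) show "?N \<subseteq> ?C" by (rule relative_elementary_least)
qed

section \<open>Congruences modulo an ideal\<close>

context
  fixes I :: "'a::ring_1 set"
  assumes I: "ideal I ring_of_type_algebra"
begin

private lemma ideal_zero: "0 \<in> I"
  and ideal_add: "x \<in> I \<Longrightarrow> y \<in> I \<Longrightarrow> x + y \<in> I"
  and ideal_mult_left: "x \<in> I \<Longrightarrow> a * x \<in> I"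
  and ideal_mult_right: "x \<in> I \<Longrightarrow> x * a \<in> I"
proof -
  interpret ideal I ring_of_type_algebra by (rule I)
  show "0 \<in> I" using additive_subgroup.zero_closed[OF ideal.axioms(1)[OF I]] by simp
  show "x \<in> I \<Longrightarrow> y \<in> I \<Longrightarrow> x + y \<in> I" using additive_subgroup.a_closed[OF ideal.axioms(1)[OF I]] by simp
  show "x \<in> I \<Longrightarrow> a * x \<in> I" using I_l_closed[of x a] by simp
  show "x \<in> I \<Longrightarrow> x * a \<in> I" using I_r_closed[of x a] by simp
qed

private lemma ideal_minus: "x \<in> I \<Longrightarrow> - x \<in> I"
  using ideal_mult_left[of x "- 1"] by simp

private lemma ideal_diff: "x \<in> I \<Longrightarrow> y \<in> I \<Longrightarrow> x - y \<in> I"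
  using ideal_add[OF _ ideal_minus] by simp

private lemma ideal_sum: "(\<And>k. k \<in> A \<Longrightarrow> f k \<in> I) \<Longrightarrow> sum f A \<in> I"
  by (induction A rule: infinite_finite_induct) (auto intro: ideal_zero ideal_add)

private lemma coset_eq_iff: "I +>\<^bsub>ring_of_type_algebra\<^esub> x = I +>\<^bsub>ring_of_type_algebra\<^esub> y \<longleftrightarrow> x - y \<in> I"
proof -
  have coset: "I +>\<^bsub>ring_of_type_algebra\<^esub> z = {a + z | a. a \<in> I}" for z
    by (auto simp: a_r_coset_def')
  show ?thesis
  proof
    assume "I +>\<^bsub>ring_of_type_algebra\<^esub> x = I +>\<^bsub>ring_of_type_algebra\<^esub> y"
    moreover have "x \<in> I +>\<^bsub>ring_of_type_algebra\<^esub> x"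
      unfolding coset using ideal_zero by force
    ultimately show "x - y \<in> I" unfolding coset by auto
  next
    assume xy: "x - y \<in> I"
    have "a + x = (a + (x - y)) + y" "a + y = (a - (x - y)) + x" for a by simp_all
    then show "I +>\<^bsub>ring_of_type_algebra\<^esub> x = I +>\<^bsub>ring_of_type_algebra\<^esub> y"
      unfolding coset using ideal_add[OF _ xy] ideal_diff[OF _ xy] by blast
  qed
qed

text \<open>Equality of reductions, expressed entrywise in the ring itself; this confines matrices
  of cosets to the comparison with \<open>full_congruence\<close>.\<close>

definition mat_cong :: "'a^'n^'n \<Rightarrow> 'a^'n^'n \<Rightarrow> bool" where
  "mat_cong A B \<longleftrightarrow> (\<forall>k l. A $ k $ l - B $ k $ l \<in> I)"

private lemma reduce_matrix_eq_iff: "reduce_matrix I A = reduce_matrix I B \<longleftrightarrow> mat_cong A B"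
  by (auto simp: reduce_matrix_def vec_eq_iff coset_eq_iff mat_cong_def)

private lemma mat_cong_refl: "mat_cong A A"
  by (simp add: mat_cong_def ideal_zero)

private lemma mat_cong_sym: "mat_cong A B \<Longrightarrow> mat_cong B A"
  unfolding mat_cong_def using ideal_minus by (metis minus_diff_eq)

private lemma mat_cong_trans: "mat_cong A B \<Longrightarrow> mat_cong B C \<Longrightarrow> mat_cong A C"
  unfolding mat_cong_def using ideal_add by (metis diff_add_cancel add_diff_eq)

private lemma mat_cong_mult_left: "mat_cong A B \<Longrightarrow> mat_cong (C ** A) (C ** B)"
  by (auto simp: mat_cong_def matrix_matrix_mult_def
      intro!: ideal_sum ideal_mult_left simp flip: sum_subtractf right_diff_distrib)

private lemma mat_cong_mult_right: "mat_cong A B \<Longrightarrow> mat_cong (A ** C) (B ** C)"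
  by (auto simp: mat_cong_def matrix_matrix_mult_def
      intro!: ideal_sum ideal_mult_right simp flip: sum_subtractf left_diff_distrib)

text \<open>An upper bound for \<open>relative_elementary I\<close>: a normal subgroup of
  \<open>elementary UNIV\<close> that contains the generators of level \<open>I\<close>.\<close>

private lemma normal_principal_congruence:
  "{g \<in> elementary UNIV. mat_cong g (mat 1)} \<lhd> (GL_type\<lparr>carrier := elementary UNIV\<rparr>)"
  (is "?D \<lhd> _")
  unfolding normal_in_elementary_iff
proof (intro conjI ballI)
  note E = subgroup_elementary[where I = UNIV]
  have GL: "g \<in> carrier GL_type" if "g \<in> elementary UNIV" for g :: "'a^'b^'b"
    using that subgroup.subset[OF E] by blast
  show "subgroup ?D GL_type"
  proof (rule group.subgroupI[OF group_GL_type])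
    show "?D \<subseteq> carrier GL_type" using GL by auto
    show "?D \<noteq> {}" using elementary_one mat_cong_refl by auto
  next
    fix g :: "'a^'b^'b" assume g: "g \<in> ?D"
    then have "mat_cong (inv\<^bsub>GL_type\<^esub> g ** g) (inv\<^bsub>GL_type\<^esub> g ** mat 1)"
      by (intro mat_cong_mult_left) simp
    then show "inv\<^bsub>GL_type\<^esub> g \<in> ?D"
      using g subgroup.m_inv_closed[OF E, of g] mat_cong_sym by (auto simp: inv_GL_type GL)
  next
    fix g h :: "'a^'b^'b" assume gh: "g \<in> ?D" "h \<in> ?D"
    then have "mat_cong (g ** h) (mat 1 ** h)" by (intro mat_cong_mult_right) simp
    then show "g \<otimes>\<^bsub>GL_type\<^esub> h \<in> ?D"
      using gh mat_cong_trans elementary_mult by auto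
  qed
  fix g h :: "'a^'b^'b" assume g: "g \<in> elementary UNIV" and h: "h \<in> ?D"
  have "mat_cong (g ** h ** inv\<^bsub>GL_type\<^esub> g) (g ** mat 1 ** inv\<^bsub>GL_type\<^esub> g)"
    using h by (intro mat_cong_mult_left mat_cong_mult_right) simp
  then show "g \<otimes>\<^bsub>GL_type\<^esub> h \<otimes>\<^bsub>GL_type\<^esub> inv\<^bsub>GL_type\<^esub> g \<in> ?D"
    using g h subgroup.m_inv_closed[OF E g] by (simp add: elementary_mult inv_GL_type GL)
qed auto

private lemma relative_elementary_cong:
  assumes "g \<in> relative_elementary I"
  shows "mat_cong g (mat 1)"
proof -
  have "mat_cong (transvection i j x) (mat 1)" if "x \<in> I" for i j :: 'b and x
    using that by (simp add: mat_cong_def transvection_def ideal_zero)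
  then have "elementary I \<subseteq> {g \<in> elementary UNIV. mat_cong g (mat 1 :: 'a^'b^'b)}"
    unfolding elementary_def[of I] using normal_principal_congruence
    by (intro group.generate_subgroup_incl[OF group_GL_type])
      (auto simp: normal_in_elementary_iff intro: transvection_mem_elementary)
  then have "relative_elementary I \<subseteq> {g \<in> elementary UNIV. mat_cong g (mat 1 :: 'a^'b^'b)}"
    by (rule relative_elementary_least[OF normal_principal_congruence])
  with assms show ?thesis by blast
qed

section \<open>Reduction to the quotient ring and the full congruence subgroup\<close>

private abbreviation "Q \<equiv> ring_of_type_algebra Quot I"

private lemma reduce_matrix_carrier: "reduce_matrix I A \<in> carrier (matrix_monoid Q)"
proof -
  interpret ideal I ring_of_type_algebra by (rule I)
  show ?thesis
    by (auto simp: reduce_matrix_def matrix_monoid_def FactRing_def intro: a_rcosetsI[OF a_subset])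
qed

private lemma reduce_matrix_mult:
  "reduce_matrix I A \<otimes>\<^bsub>matrix_monoid Q\<^esub> reduce_matrix I B = reduce_matrix I (A ** B)"
proof -
  interpret ideal I ring_of_type_algebra by (rule I)
  interpret Q: ring Q by (rule quotient_is_ring)
  let ?\<phi> = "(+>\<^bsub>ring_of_type_algebra\<^esub>) I"
  note \<phi> = rcos_ring_hom
  have sum: "finsum Q (\<lambda>k. ?\<phi> (f k)) A = ?\<phi> (sum f A)" if "finite A" for f and A :: "'b set"
    using that
  proof induction
    case empty
    have "\<zero>\<^bsub>Q\<^esub> = I" by (simp add: FactRing_def)
    then show ?case using a_coset_add_zero[OF a_subset] by simp
  next
    case (insert k A)
    have "?\<phi> x \<in> carrier Q" for x using ring_hom_closed[OF \<phi>] by simp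
    then show ?case
      using insert ring_hom_add[OF \<phi>, of "f k" "sum f A"] by simp
  qed
  show ?thesis
    using ring_hom_mult[OF \<phi>]
    by (simp add: matrix_monoid_def reduce_matrix_def vec_eq_iff matrix_matrix_mult_def flip: sum)
qed

private lemma reduce_matrix_one: "\<one>\<^bsub>matrix_monoid Q\<^esub> = reduce_matrix I (mat 1)"
proof -
  interpret ideal I ring_of_type_algebra by (rule I)
  have "I +>\<^bsub>ring_of_type_algebra\<^esub> 0 = I" using a_coset_add_zero[OF a_subset] by simp
  then show ?thesis
    by (simp add: matrix_monoid_def reduce_matrix_def vec_eq_iff mat_def FactRing_def)
qed

private lemma reduce_matrix_GL:
  assumes "g \<in> carrier GL_type"
  shows "reduce_matrix I g \<in> carrier (GL Q)"
proof -
  obtain h where "g ** h = mat 1" "h ** g = mat 1" using assms by (auto simp: carrier_GL_type)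
  then show ?thesis
    unfolding GL_def units_of_carrier Units_def
    by (auto simp: reduce_matrix_one reduce_matrix_mult reduce_matrix_carrier intro!: bexI[of _ "reduce_matrix I h"])
qed

lemma relative_elementary_subset_full_congruence: "relative_elementary I \<subseteq> full_congruence I"
proof
  interpret ideal I ring_of_type_algebra by (rule I)
  fix g :: "'a^'b^'b" assume g: "g \<in> relative_elementary I"
  then have GL: "g \<in> carrier GL_type" using subgroup.subset[OF subgroup_relative_elementary] by blast
  have "reduce_matrix I g = \<one>\<^bsub>GL Q\<^esub>"
    using relative_elementary_cong[OF g]
    by (simp add: GL_def units_of_one reduce_matrix_one reduce_matrix_eq_iff)
  \<comment> \<open>Entrywise representatives lift \<open>A\<close> to a matrix over the ring,
    invertible or not. The identity laws then follow from those for \<open>mat 1\<close>.\<close>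
  moreover have "\<one>\<^bsub>GL Q\<^esub> \<otimes>\<^bsub>GL Q\<^esub> A = A" "A \<otimes>\<^bsub>GL Q\<^esub> \<one>\<^bsub>GL Q\<^esub> = A" if "A \<in> carrier (GL Q)" for A :: "'a set^'b^'b"
  proof -
    have "A $ i $ j \<in> carrier Q" for i j
      using that by (auto simp: GL_def units_of_carrier Units_def matrix_monoid_def)
    then have "\<exists>a. A $ i $ j = I +>\<^bsub>ring_of_type_algebra\<^esub> a" for i j
      by (auto simp: FactRing_def A_RCOSETS_def')
    then obtain a where "\<And>i j. A $ i $ j = I +>\<^bsub>ring_of_type_algebra\<^esub> a i j" by metis
    then have "A = reduce_matrix I (\<chi> i j. a i j)"
      by (simp add: reduce_matrix_def vec_eq_iff)
    then show "\<one>\<^bsub>GL Q\<^esub> \<otimes>\<^bsub>GL Q\<^esub> A = A" "A \<otimes>\<^bsub>GL Q\<^esub> \<one>\<^bsub>GL Q\<^esub> = A"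
      by (simp_all add: GL_def units_of_one units_of_mult reduce_matrix_one reduce_matrix_mult)
  qed
  ultimately show "g \<in> full_congruence I"
    using GL reduce_matrix_GL[OF GL] by (simp add: full_congruence_def group_center_def)
qed

private lemma full_congruence_cong:
  assumes "g \<in> full_congruence I" "h \<in> carrier GL_type"
  shows "mat_cong (g ** h) (h ** g)"
proof -
  have "reduce_matrix I g \<otimes>\<^bsub>GL Q\<^esub> reduce_matrix I h = reduce_matrix I h \<otimes>\<^bsub>GL Q\<^esub> reduce_matrix I g"
    using assms reduce_matrix_GL[OF assms(2)] by (auto simp: full_congruence_def group_center_def)
  then show ?thesis
    by (simp add: GL_def units_of_mult reduce_matrix_mult reduce_matrix_eq_iff)
qed

text \<open>Everything comes from comparing entries after commuting with a single transvection:
  position \<open>(k, j)\<close> for \<open>g\<close>, position \<open>(i, k)\<close> for its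
  inverse, and position \<open>(i, j)\<close> of the conjugate for the diagonal relation.\<close>

private lemma full_congruence_entries:
  fixes g gi :: "'a^'n^'n"
  assumes g: "g \<in> full_congruence I" and gi: "g ** gi = mat 1" "gi ** g = mat 1" and ij: "i \<noteq> j"
  shows "k \<noteq> i \<Longrightarrow> g $ k $ i \<in> I" "k \<noteq> j \<Longrightarrow> gi $ j $ k \<in> I" "g $ i $ i * x * gi $ j $ j - x \<in> I"
proof -
  let ?t = "transvection i j :: 'a \<Rightarrow> 'a^'n^'n"
  have gt: "mat_cong (g ** ?t x) (?t x ** g)" for x
    using g transvection_carrier_GL[OF ij] by (rule full_congruence_cong)
  have right: "(A ** ?t x) $ k $ l = A $ k $ l + (if l = j then A $ k $ i * x else 0)"
    for A :: "'a^'n^'n" and x k l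
    unfolding transvection_eq_outer(1) matrix_add_ldistrib matrix_mult_outer
    by (simp add: outer_def matrix_vector_mult_def
        if_distrib[of "\<lambda>x. _ * x"] cong: if_cong)
  have left: "(?t x ** A) $ k $ l = A $ k $ l + (if k = i then x * A $ j $ l else 0)"
    for A :: "'a^'n^'n" and x k l
    unfolding transvection_eq_outer(2) matrix_add_rdistrib matrix_mult_outer
    by (simp add: outer_def vector_matrix_mult_def
        if_distrib[of "\<lambda>x. x * _"] cong: if_cong)
  show "g $ k $ i \<in> I" if "k \<noteq> i"
    using gt[of 1, unfolded mat_cong_def, rule_format, of k j] that by (simp add: left right)
  \<comment> \<open>Multiplying by \<open>gi\<close> on both sides transfers the congruence from
    \<open>g\<close> to its inverse.\<close>
  have "mat_cong (gi ** (g ** ?t x) ** gi) (gi ** (?t x ** g) ** gi)" for x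
    by (intro mat_cong_mult_left mat_cong_mult_right gt)
  moreover have "gi ** (g ** ?t x) ** gi = ?t x ** gi" for x
    using gi by (simp add: matrix_mul_assoc)
  moreover have "gi ** (?t x ** g) ** gi = gi ** ?t x" for x
    using gi by (simp flip: matrix_mul_assoc)
  ultimately have tgi: "mat_cong (?t x ** gi) (gi ** ?t x)" for x by simp
  show "gi $ j $ k \<in> I" if "k \<noteq> j"
    using tgi[of 1, unfolded mat_cong_def, rule_format, of i k] that by (simp add: left right)
  have "mat_cong (g ** ?t x ** gi) (?t x ** g ** gi)"
    by (intro mat_cong_mult_right gt)
  also have "?t x ** g ** gi = ?t x" using gi by (simp flip: matrix_mul_assoc)
  finally have "(g ** ?t x ** gi) $ i $ j - ?t x $ i $ j \<in> I" by (simp add: mat_cong_def)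
  moreover have "(g ** ?t x ** gi) $ i $ j = g $ i $ i * x * gi $ j $ j"
    unfolding transvection_eq_outer(1) conj_one_plus_outer[OF gi(1)] using ij
    by (simp add: outer_def mat_def matrix_vector_mult_def vector_matrix_mult_def
        if_distrib[of "\<lambda>x. _ * x"] if_distrib[of "\<lambda>x. x * _"] cong: if_cong)
  ultimately show "g $ i $ i * x * gi $ j $ j - x \<in> I"
    using ij by (simp add: transvection_def mat_def)
qed

section \<open>The commutator formula\<close>

text \<open>The entries of \<open>a\<close> off position \<open>k\<close> give transvections of
  level \<open>I\<close>. The remaining diagonal perturbation \<open>a $ k * z\<close> is the
  commutator of \<open>transvection k m (a $ k)\<close> and \<open>transvection m k z\<close>,
  thanks to \<open>z * a $ k = 0\<close>. Grouped as a level \<open>I\<close> element times a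
  conjugate of one, it lies in the relative group although \<open>z\<close> is arbitrary.\<close>

lemma one_plus_outer_axis_mem:
  fixes a :: "'a^'n"
  assumes n: "CARD('n) \<ge> 2" and a: "\<And>l. a $ l \<in> I" and z: "z * a $ k = 0"
  shows "mat 1 + outer a (axis k z) \<in> relative_elementary I"
proof -
  have "\<exists>m. m \<noteq> k"
  proof (rule ccontr)
    assume "\<nexists>m. m \<noteq> k"
    then have "UNIV = {k}" by auto
    then have "CARD('n) = card {k}" by simp
    then show False using n by simp
  qed
  then obtain m where m: "k \<noteq> m" by metis
  let ?N = "relative_elementary I :: ('a^'n^'n) set"
  have "transvection k m (a $ k) ** (transvection m k z ** transvection k m (- (a $ k)) ** transvection m k (- z)) \<in> ?N"
    using a m ideal_minus
    by (intro relative_elementary_mult transvection_conj_mem_relative_elementary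
        transvection_mem_relative_elementary) auto
  also have "transvection k m (a $ k) ** (transvection m k z ** transvection k m (- (a $ k)) ** transvection m k (- z)) =
      mat 1 + outer (axis k (a $ k)) (axis k z)"
  proof -
    have "transvection m k z ** transvection k m (- (a $ k)) ** transvection m k (- z) =
      mat 1 + outer (transvection m k z *v axis k (- (a $ k))) (axis m 1 v* transvection m k (- z))"
      unfolding transvection_eq_outer(1)[of k]
      using m by (intro conj_one_plus_outer) (simp add: transvection_add)
    also have "transvection m k z *v axis k (- (a $ k)) = axis k (- (a $ k))"
      using z by (auto simp: transvection_eq_outer(1) vec_eq_iff matrix_vector_mult_one_plus_outer)
    also have "axis m 1 v* transvection m k (- z) = axis m 1 + axis k (- z)"
      using m by (auto simp: transvection_eq_outer(1) vec_eq_iff vector_matrix_mult_one_plus_outer)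
    finally have conj: "transvection m k z ** transvection k m (- (a $ k)) ** transvection m k (- z) =
      mat 1 + outer (axis k (- (a $ k))) (axis m 1 + axis k (- z))" .
    show ?thesis
      unfolding conj unfolding transvection_eq_outer(1)[of k m] using m
      by (subst one_plus_outer_mult) (auto simp: outer_def vec_eq_iff)
  qed
  finally have 1: "mat 1 + outer (axis k (a $ k)) (axis k z) \<in> ?N" .
  define b where "b = (\<chi> l. if l = k then 0 else a $ l * z)"
  have 2: "mat 1 + outer b (axis k 1) \<in> ?N"
    by (rule one_plus_outer_column_mem)
      (auto simp: b_def a relative_elementary_one relative_elementary_mult ideal_mult_right
        intro!: transvection_mem_relative_elementary)
  have "(mat 1 + outer b (axis k 1)) ** (mat 1 + outer (axis k (a $ k)) (axis k z)) =
      mat 1 + outer b (axis k 1) + outer (axis k (a $ k)) (axis k z)"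
  proof -
    \<comment> \<open>Moving \<open>z\<close> from the column back to the row turns the cross term
      scalar \<open>a $ k\<close> into \<open>z * a $ k\<close>, which is zero.\<close>
    have "outer b (axis k 1) = outer (\<chi> l. if l = k then 0 else a $ l) (axis k z)"
      by (auto simp: outer_def b_def vec_eq_iff)
    then show ?thesis using z by (simp add: one_plus_outer_mult)
  qed
  also have "\<dots> = mat 1 + outer a (axis k z)"
    by (auto simp: outer_def b_def vec_eq_iff)
  finally show ?thesis using relative_elementary_mult[OF 2 1] by simp
qed

text \<open>
  Modulo \<open>I\<close> all \<open>e k\<close> with \<open>k \<noteq> j\<close> vanish, and the column operations for the remaining pivot \<open>j\<close>
  have entries in \<open>I\<close>; therefore only the factor for \<open>j\<close> contributes \<open>transvection i j x\<close>.
\<close>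

lemma conj_transvection_mem:
  fixes g gi :: "'a^'n^'n"
  assumes ex: "exchange_ring TYPE('a)" and n: "CARD('n) \<ge> 2" and ij: "i \<noteq> j"
    and gi: "g ** gi = mat 1" "gi ** g = mat 1"
    and col: "\<And>k. k \<noteq> i \<Longrightarrow> g $ k $ i \<in> I" and row: "\<And>k. k \<noteq> j \<Longrightarrow> gi $ j $ k \<in> I"
    and diag: "\<And>x. g $ i $ i * x * gi $ j $ j - x \<in> I"
  shows "g ** transvection i j x ** gi ** transvection i j (- x) \<in> relative_elementary I"
proof -
  let ?N = "relative_elementary I :: ('a^'n^'n) set"
  define u v :: "'a^'n" where "u = (\<chi> k. g $ k $ i)" and "v = gi $ j"
  \<comment> \<open>Entry \<open>(j, i)\<close> of \<open>gi ** g\<close> yields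
    \<open>dot v u = 0\<close>; entry \<open>(j, j)\<close> makes the \<open>j\<close>-th column of
    \<open>g\<close> a right inverse of the row \<open>v\<close>.\<close>
  have "(gi ** g) $ j $ i = 0" "(gi ** g) $ j $ j = 1" using gi ij by (simp_all add: mat_def)
  then have vu: "dot v u = 0" and "(\<Sum>k\<in>UNIV. v $ k * g $ k $ j) = 1"
    by (simp_all add: dot_def u_def v_def matrix_matrix_mult_def)
  from exchange_ring_idempotents[OF ex this(2)]
  obtain r where r: "(\<Sum>k\<in>UNIV. v $ k * r k) = 1"
    and idem: "\<And>k. v $ k * r k * (v $ k * r k) = v $ k * r k" by auto
  define e where "e k = v $ k * r k" for k
  have e_idem: "e k * e k = e k" for k by (simp add: e_def idem)
  have e_ideal: "e k \<in> I" if "k \<noteq> j" for k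
    using row[OF that] by (simp add: e_def v_def ideal_mult_right)
  define F where "F y = mat 1 + outer (\<chi> k. u $ k * y) v" for y
  have dot_uy: "dot v (\<chi> k. u $ k * y) = 0" for y
    using vu by (simp add: dot_def flip: mult.assoc sum_distrib_right)
  have F_add: "F (y + z) = F y ** F z" for y z
    unfolding F_def one_plus_outer_mult[OF dot_uy]
    by (simp add: outer_def vec_eq_iff algebra_simps)
  have F_conj: "g ** transvection i j x ** gi = F x"
    unfolding transvection_eq_outer(1) conj_one_plus_outer[OF gi(1)] F_def
    by (simp add: outer_def vec_eq_iff matrix_vector_mult_def vector_matrix_mult_def u_def v_def
        if_distrib[of "\<lambda>x. _ * x"] if_distrib[of "\<lambda>x. x * _"] cong: if_cong)

  define w where "w k = (\<chi> l. if l = k then 0 else r k * v $ l)" for k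
  define h h' where "h k = mat 1 + outer (axis k 1) (- w k)"
    and "h' k = mat 1 + outer (axis k 1) (w k)" for k
  define a where "a k = h' k *v (\<chi> l. u $ l * (x * e k))" for k
  have hh': "h k ** h' k = mat 1" "h' k ** h k = mat 1" for k
    unfolding h_def h'_def by (subst one_plus_outer_mult; simp add: w_def outer_minus)+
  \<comment> \<open>The pivot lemma is applied to the column with entries
    \<open>u $ l * (x * e k)\<close>, which absorbs \<open>e k\<close> on the right by
    idempotence.\<close>
  have pivot: "F (x * e k) = h k ** (mat 1 + outer (a k) (axis k (e k * v $ k))) ** h' k"
      "e k * v $ k * a k $ k = 0"
      "a k $ l = (if l = k then u $ k * (x * e k) - r k * v $ k * (u $ k * (x * e k)) else u $ l * (x * e k))"
    for k l
    using one_plus_outer_pivot[of "e k" v k "r k" "\<chi> l. u $ l * (x * e k)" "w k" "a k"]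
      e_idem[of k] dot_uy[of "x * e k"]
    unfolding a_def w_def h_def h'_def F_def by (simp_all add: e_def mult.assoc)
  have h_elementary: "h k \<in> elementary UNIV" for k
    unfolding h_def
    by (rule one_plus_outer_row_mem)
      (auto simp: w_def elementary_one intro: elementary_mult transvection_mem_elementary)
  have h_relative: "h j \<in> ?N" "h' j \<in> ?N"
    unfolding h_def h'_def
    by (rule one_plus_outer_row_mem;
        auto simp: w_def relative_elementary_one relative_elementary_mult row v_def
          intro!: transvection_mem_relative_elementary ideal_minus ideal_mult_left)+

  \<comment> \<open>The column \<open>a k\<close> has entries in \<open>I\<close> because
    \<open>e k\<close> does. The outer factors \<open>h k\<close> and \<open>h' k\<close> are
    mutually inverse and elementary, so they act by a conjugation that preserves
    \<open>?N\<close>.\<close>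
  have F_off: "F (x * e k) \<in> ?N" if k: "k \<noteq> j" for k
  proof -
    have xe: "y * (x * e k) \<in> I" for y using e_ideal[OF k] by (intro ideal_mult_left)
    then have "a k $ l \<in> I" for l
      unfolding pivot(3) by (auto intro: ideal_diff ideal_mult_left)
    then have "mat 1 + outer (a k) (axis k (e k * v $ k)) \<in> ?N"
      using pivot(2) by (intro one_plus_outer_axis_mem n)
    then show ?thesis
      unfolding pivot(1) by (intro relative_elementary_conj h_elementary hh')
  qed
  have F_off_sum: "F (\<Sum>k\<in>T. x * e k) \<in> ?N" if "j \<notin> T" for T
    using that
  proof (induction T rule: infinite_finite_induct)
    case empty
    have "F 0 = mat 1" by (simp add: F_def outer_def vec_eq_iff)
    then show ?case by (simp add: relative_elementary_one)
  next
    case (insert k T)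
    then show ?case by (auto simp: F_add intro: relative_elementary_mult F_off)
  qed simp
  have "(\<Sum>k\<in>UNIV. e k) = 1" using r by (simp add: e_def)
  then have e_sum: "e j + (\<Sum>k\<in>- {j}. e k) = 1"
    using sum.remove[of UNIV j e] by (simp add: Compl_eq_Diff_UNIV)
  then have "x * e j + (\<Sum>k\<in>- {j}. x * e k) = x"
    by (metis distrib_left mult_1_right sum_distrib_left)
  then have F_split: "F x = F (x * e j) ** F (\<Sum>k\<in>- {j}. x * e k)"
    by (metis F_add)

  \<comment> \<open>\<open>y\<close> is the \<open>(i, j)\<close> entry of the perturbation by
    \<open>a j\<close>, and \<open>b\<close> is the rest of that column. Since
    \<open>1 - e j\<close> is in \<open>I\<close>, \<open>y\<close> is congruent to
    \<open>u $ i * x * v $ j\<close> and hence to \<open>x\<close>.\<close>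
  define y where "y = u $ i * (x * e j) * (e j * v $ j)"
  define b where "b = (\<chi> l. if l = i then 0 else a j $ l)"
  have y: "y - x \<in> I"
  proof -
    have "y - x = (u $ i * x * v $ j - x) - u $ i * x * (\<Sum>k\<in>- {j}. e k) * v $ j"
    proof -
      have "y = u $ i * x * (e j * e j) * v $ j" by (simp add: y_def mult.assoc)
      also have "\<dots> = u $ i * x * (1 - (\<Sum>k\<in>- {j}. e k)) * v $ j"
        using e_idem[of j] by (simp flip: e_sum)
      finally show ?thesis by (simp add: algebra_simps)
    qed
    moreover have "(\<Sum>k\<in>- {j}. e k) \<in> I" using e_ideal by (intro ideal_sum) auto
    moreover have "u $ i * x * v $ j - x \<in> I" using diag by (simp add: u_def v_def)
    ultimately show ?thesis
      by (simp only: ideal_diff ideal_mult_left ideal_mult_right)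
  qed
  have u_ideal: "l \<noteq> i \<Longrightarrow> u $ l * z \<in> I" for l z
    using col by (simp add: u_def ideal_mult_right)
  have "b $ l \<in> I" for l
    using u_ideal[of l] u_ideal[of j] ij unfolding b_def pivot(3)
    by (auto intro: ideal_zero ideal_diff ideal_mult_left)
  moreover have "e j * v $ j * b $ j = 0" using pivot(2)[of j] ij by (simp add: b_def)
  ultimately have b: "mat 1 + outer b (axis j (e j * v $ j)) \<in> ?N"
    by (intro one_plus_outer_axis_mem n)
  have "mat 1 + outer (a j) (axis j (e j * v $ j)) =
      (mat 1 + outer b (axis j (e j * v $ j))) ** transvection i j y"
  proof -
    have "a j $ i = u $ i * (x * e j)" using ij pivot(3)[of j i] by simp
    then have "outer (a j) (axis j (e j * v $ j)) = outer b (axis j (e j * v $ j)) + outer (axis i 1) (axis j y)"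
      by (auto simp: outer_def vec_eq_iff b_def y_def)
    then show ?thesis
      unfolding transvection_eq_outer(2) using ij by (simp add: one_plus_outer_mult add.assoc)
  qed
  then have F_diag: "F (x * e j) =
      h j ** (mat 1 + outer b (axis j (e j * v $ j))) ** transvection i j y ** h' j"
    by (simp add: pivot(1) matrix_mul_assoc)
  let ?P = "F (\<Sum>k\<in>- {j}. x * e k)"
  \<comment> \<open>Inserting \<open>transvection i j (- y)\<close> and its inverse isolates a
    conjugate of \<open>h' j ** ?P\<close> and leaves \<open>transvection i j (y - x)\<close>, of
    level \<open>I\<close>, at the end; each factor is then in \<open>?N\<close>.\<close>
  have "h j ** (mat 1 + outer b (axis j (e j * v $ j))) **
      (transvection i j y ** (h' j ** ?P) ** transvection i j (- y)) ** transvection i j (y - x) \<in> ?N"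
    using b h_relative ij y F_off_sum[of "- {j}"]
    by (intro relative_elementary_mult transvection_conj_mem_relative_elementary
        transvection_mem_relative_elementary) auto
  also have "h j ** (mat 1 + outer b (axis j (e j * v $ j))) **
      (transvection i j y ** (h' j ** ?P) ** transvection i j (- y)) ** transvection i j (y - x) =
      F x ** transvection i j (- x)"
    using ij by (simp add: F_split F_diag transvection_add flip: matrix_mul_assoc)
  finally show ?thesis by (simp add: F_conj)
qed

text \<open>By \<open>commutator_generate_mem\<close> it suffices to treat a transvection
  \<open>s\<close>. There \<open>conj_transvection_mem\<close> gives the commutator of
  \<open>g\<close> and \<open>s\<close>, whose inverse is the commutator of \<open>s\<close> and
  \<open>g\<close>.\<close>

lemma commutator_full_congruence_subset:
  assumes ex: "exchange_ring TYPE('a)" and n: "CARD('n::finite) \<ge> 2"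
  shows "commutator_subgroup GL_type (elementary UNIV) (full_congruence I) \<subseteq>
    (relative_elementary I :: ('a^'n^'n) set)"
  unfolding commutator_subgroup_def
proof (rule group.generate_subgroup_incl[OF group_GL_type _ subgroup_relative_elementary])
  let ?N = "relative_elementary I :: ('a^'n^'n) set"
  interpret GL: group "GL_type :: ('a^'n^'n) monoid" by (rule group_GL_type)
  have "h \<otimes>\<^bsub>GL_type\<^esub> g \<otimes>\<^bsub>GL_type\<^esub> inv\<^bsub>GL_type\<^esub> h \<otimes>\<^bsub>GL_type\<^esub> inv\<^bsub>GL_type\<^esub> g \<in> ?N"
    if h: "h \<in> elementary UNIV" and g: "g \<in> full_congruence I" for h g :: "'a^'n^'n"
  proof (rule GL.commutator_generate_mem[OF transvections_subset_GL, folded elementary_def])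
    have g_GL: "g \<in> carrier GL_type" using g by (simp add: full_congruence_def)
    then show "g \<in> carrier GL_type" .
    show "?N \<lhd> (GL_type\<lparr>carrier := elementary UNIV\<rparr>)" by (rule normal_relative_elementary)
    show "h \<in> elementary UNIV" by (rule h)
    fix s :: "'a^'n^'n" assume "s \<in> {transvection i j x | i j x. i \<noteq> j \<and> x \<in> UNIV}"
    then obtain i j x where s: "s = transvection i j x" and ij: "i \<noteq> j" by auto
    then have s_GL: "s \<in> carrier GL_type" by (simp add: transvection_carrier_GL)
    note inv = inv_GL_type[OF g_GL]
    have "g ** s ** inv\<^bsub>GL_type\<^esub> g ** inv\<^bsub>GL_type\<^esub> s \<in> ?N"
      unfolding s inv_transvection[OF ij]
      by (intro conj_transvection_mem[OF ex n ij inv] full_congruence_entries[OF g inv ij])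
    then have "inv\<^bsub>GL_type\<^esub> (g ** s ** inv\<^bsub>GL_type\<^esub> g ** inv\<^bsub>GL_type\<^esub> s) \<in> ?N"
      by (rule subgroup.m_inv_closed[OF subgroup_relative_elementary])
    also have "inv\<^bsub>GL_type\<^esub> (g ** s ** inv\<^bsub>GL_type\<^esub> g ** inv\<^bsub>GL_type\<^esub> s) =
        s ** g ** inv\<^bsub>GL_type\<^esub> s ** inv\<^bsub>GL_type\<^esub> g"
      using GL.inv_mult_group[of "g ** s ** inv\<^bsub>GL_type\<^esub> g" "inv\<^bsub>GL_type\<^esub> s"]
        GL.inv_mult_group[of "g ** s" "inv\<^bsub>GL_type\<^esub> g"] GL.inv_mult_group[of g s] g_GL s_GL
        GL.m_closed[of g s] GL.m_closed[of "g ** s" "inv\<^bsub>GL_type\<^esub> g"]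
      by (simp add: matrix_mul_assoc)
    finally show "s \<otimes>\<^bsub>GL_type\<^esub> g \<otimes>\<^bsub>GL_type\<^esub> inv\<^bsub>GL_type\<^esub> s \<otimes>\<^bsub>GL_type\<^esub> inv\<^bsub>GL_type\<^esub> g \<in> ?N" by simp
  qed
  then show "{h \<otimes>\<^bsub>GL_type\<^esub> k \<otimes>\<^bsub>GL_type\<^esub> inv\<^bsub>GL_type\<^esub> h \<otimes>\<^bsub>GL_type\<^esub> inv\<^bsub>GL_type\<^esub> k | h k.
      h \<in> elementary UNIV \<and> k \<in> full_congruence I} \<subseteq> ?N" by blast
qed

end

theorem theorem2:
  fixes I :: "'a::ring_1 set"
  assumes "exchange_ring TYPE('a)"
    and "CARD('n::finite) \<ge> 3"
    and "ideal I ring_of_type_algebra"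
  shows "(relative_elementary I :: ('a^'n^'n) set)
           = commutator_subgroup GL_type (elementary UNIV) (relative_elementary I) \<and>
         commutator_subgroup GL_type (elementary UNIV) (relative_elementary I :: ('a^'n^'n) set)
           = commutator_subgroup GL_type (elementary UNIV) (full_congruence I)"
proof (intro conjI equalityI)
  show "commutator_subgroup GL_type (elementary UNIV) (relative_elementary I :: ('a^'n^'n) set)
      \<subseteq> commutator_subgroup GL_type (elementary UNIV) (full_congruence I)"
    unfolding commutator_subgroup_def
    using relative_elementary_subset_full_congruence[OF assms(3)]
    by (intro group.mono_generate[OF group_GL_type]) blast
  show "commutator_subgroup GL_type (elementary UNIV) (full_congruence I)
      \<subseteq> commutator_subgroup GL_type (elementary UNIV) (relative_elementary I :: ('a^'n^'n) set)"
    \<comment> \<open>The first equality replaces the right-hand commutator subgroup by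
      \<open>relative_elementary I\<close>.\<close>
    unfolding relative_elementary_eq_commutator[OF assms(2), symmetric]
    using assms by (intro commutator_full_congruence_subset) auto
qed (use relative_elementary_eq_commutator[OF assms(2)] in blast)+

end
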